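(* Let $F$ be a non-abelian free group with free generating set $S$. Let $\mathcal{P}\subset F$ be a symmetric subset not containing the neutral element, let $\Delta\colon F\to \mathcal{P}^\ast$ be a $\Delta$-decomposition of $F$ into the pieces $\mathcal{P}$, and let $\lambda\colon\mathcal{P}\to\mathbb{R}$ be a bounded map that is alternating, i.e., $\lambda(p^{-1})=-\lambda(p)$ for all $p\in\mathcal{P}$. Then $\phi_{\lambda,\Delta}\colon F\to\mathbb{R}$ is a quasimorphism of $F$. Furthermore, for all $\alpha_1\in H_{b}^{n}(F;\mathbb{R})$ and $\alpha_2\in H_{b}^{m}(F;\mathbb{R})$, the cup products $\alpha_1 \cup [\delta^1\widehat{\phi_{\lambda,\Delta}}]$ and $[\delta^1\widehat{\phi_{\lambda,\Delta}}]\cup \alpha_2$ as well as the Massey triple product $\langle \alpha_1, [\delta^1\widehat{\phi_{\lambda,\Delta}}], \alpha_2 \rangle$ are trivial.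
   Context: Bounded cohomology: for a discrete group $\Gamma$, $C^n_b(\Gamma;\mathbb{R})=\ell^\infty(\Gamma^{n+1},\mathbb{R})^\Gamma$ is the space of bounded functions invariant under the diagonal left translation action, with the simplicial coboundary $\delta^n f(g_0,\ldots,g_{n+1})=\sum_{i=0}^{n+1}(-1)^i f(g_0,\ldots,\widehat{g_i},\ldots,g_{n+1})$; its cohomology is $H^*_b(\Gamma;\mathbb{R})$. The cup product is induced by $(f\cup g)(g_0,\ldots,g_{p+q})=f(g_0,\ldots,g_p)\,g(g_p,\ldots,g_{p+q})$. Massey triple product: let $\alpha_1\in H_b^p$, $\alpha\in H_b^k$, $\alpha_2\in H_b^q$ with $\alpha_1\cup\alpha=0$ and $\alpha\cup\alpha_2=0$. Then $\langle\alpha_1,\alpha,\alpha_2\rangle\subset H^{p+q+k-1}_b(\Gamma;\mathbb{R})$ is the set of all classes $(-1)^k[(-1)^p\omega_1\cup\beta_2-\beta_1\cup\omega_2]$ where $\omega_1,\omega,\omega_2$ are cocycles representing $\alpha_1,\alpha,\alpha_2$, and $\beta_1,\beta_2$ are bounded $\Gamma$-invariant cochains with $\delta\beta_1=\omega_1\cup\omega$ and $\delta\beta_2=\omega\cup\omega_2$. It is called trivial if it contains the zero class. Quasimorphism of $\Gamma$: a map $\varphi\colon\Gamma\to\mathbb{R}$ with $\sup_{g,h\in\Gamma}|\varphi(g)+\varphi(h)-\varphi(gh)|<\infty$. Put $\widehat{\varphi}\colon\Gamma^2\to\mathbb{R}$, $(g,h)\mapsto\varphi(g^{-1}h)$; then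 $\delta^1\widehat{\varphi}$ is a bounded $\Gamma$-invariant cocycle and defines a class $[\delta^1\widehat{\varphi}]\in H^2_b(\Gamma;\mathbb{R})$. Sequences: elements of $F$ are viewed as reduced words over $S\cup S^{-1}$. A subset $A\subset F$ is symmetric if $a\in A$ implies $a^{-1}\in A$. $A^\ast$ is the set of finite sequences in $A$, including the empty one. For $s=(a_1,\ldots,a_n)\in A^\ast$, the length of $s$ is $n$ and $s^{-1}=(a_n^{-1},\ldots,a_1^{-1})$. The common sequence of $s$ and $t=(b_1,\ldots,b_m)$ is $(a_1,\ldots,a_r)$ where $r\leq\min\{m,n\}$ is the largest integer with $a_j=b_j$ for all $j\leq r$ (empty if $a_1\neq b_1$). The concatenation is $s\cdot t=(a_1,\ldots,a_n,b_1,\ldots,b_m)$ (without reduction). $\Delta$-decomposition: let $\mathcal{P}\subset F$ be symmetric, not containing the neutral element. A $\Delta$-decomposition of $F$ into the pieces $\mathcal{P}$ is a map $\Delta\colon F\to\mathcal{P}^\ast$ assigning to every $g\in F$ a sequence $\Delta(g)=(g_1,\ldots,g_n)$ such that (1) the reduced expression of $g$ over $S\cup S^{-1}$ is the concatenation, without cancellation, of the words $g_1,\ldots,g_n$; (2) $\Delta(g^{-1})=\Delta(g)^{-1}$; (3) for all $1\leq i\leq j\leq n$, $\Delta(g_i\cdots g_j)=(g_i,\ldots,g_j)$; and (4) there is a constant $R\in\mathbb{N}$ such that the following holds for all $g,h\in F$: let $c_1,c_2,c_3\in\mathcal{P}^\ast$ be such that $c_1^{-1}$ is the common sequence of $\Delta(g)$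 and $\Delta(gh)$, $c_2^{-1}$ is the common sequence of $\Delta(g^{-1})$ and $\Delta(h)$, and $c_3^{-1}$ is the common sequence of $\Delta(h^{-1})$ and $\Delta((gh)^{-1})$, and let $r_1,r_2,r_3\in\mathcal{P}^\ast$ be the sequences uniquely determined by $\Delta(g)=c_1^{-1}\cdot r_1\cdot c_2$, $\Delta(h)=c_2^{-1}\cdot r_2\cdot c_3$, $\Delta(gh)=c_1^{-1}\cdot r_3^{-1}\cdot c_3$; then $r_1,r_2,r_3$ have length at most $R$. $\Delta$-decomposable quasimorphism: $\phi_{\lambda,\Delta}(g)=\sum_{i=1}^n\lambda(g_i)$, where $\Delta(g)=(g_1,\ldots,g_n)$.
   Formalization: The degrees n and m are taken to be at least 1; in degree 0 the claim fails, since the unit class 1 in H_b^0 gives 1 ∪ [δ¹φ̂] = [δ¹φ̂], which is non-zero for Brooks quasimorphisms. *)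

theory Defs
  imports "HOL-Algebra.Algebra" "HOL-Library.Sublist" Complex_Main
begin

section \<open>Free groups and reduced words\<close>

text \<open>
  A letter \<open>(s, True)\<close> stands for \<open>s\<close> and \<open>(s, False)\<close> for \<open>s\<inverse>\<close>. Letters are formal, so that
  freeness excludes, e.g., an involution in \<open>S\<close> or both \<open>s\<close> and \<open>s\<inverse>\<close> in \<open>S\<close>.
\<close>

type_synonym 'a letter = "'a \<times> bool"

definition reduced_words :: "'a set \<Rightarrow> 'a letter list set" where
  "reduced_words S = {w. fst ` set w \<subseteq> S \<and>
     (\<forall>i. Suc i < length w \<longrightarrow> w ! Suc i \<noteq> (fst (w ! i), \<not> snd (w ! i)))}"

definition group_prod :: "('a, 'b) monoid_scheme \<Rightarrow> 'a list \<Rightarrow> 'a" where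
  "group_prod G xs = foldr (\<lambda>x y. x \<otimes>\<^bsub>G\<^esub> y) xs \<one>\<^bsub>G\<^esub>"

definition word_eval :: "('a, 'b) monoid_scheme \<Rightarrow> 'a letter list \<Rightarrow> 'a" where
  "word_eval G w = group_prod G (map (\<lambda>(s, b). if b then s else inv\<^bsub>G\<^esub> s) w)"

definition freely_generated :: "('a, 'b) monoid_scheme \<Rightarrow> 'a set \<Rightarrow> bool" where
  "freely_generated G S \<longleftrightarrow>
     S \<subseteq> carrier G \<and> bij_betw (word_eval G) (reduced_words S) (carrier G)"

definition reduced_word :: "('a, 'b) monoid_scheme \<Rightarrow> 'a set \<Rightarrow> 'a \<Rightarrow> 'a letter list" where
  "reduced_word G S g = inv_into (reduced_words S) (word_eval G) g"


section \<open>Bounded cohomology\<close>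

text \<open>
  An \<open>n\<close>-cochain is a function on lists of \<open>n + 1\<close> group elements. As HOL functions are total,
  cochains are required to vanish on all other lists.
\<close>

definition tuples :: "('a, 'b) monoid_scheme \<Rightarrow> nat \<Rightarrow> 'a list set" where
  "tuples G n = {xs. length xs = Suc n \<and> set xs \<subseteq> carrier G}"

definition bounded_cochains :: "('a, 'b) monoid_scheme \<Rightarrow> nat \<Rightarrow> ('a list \<Rightarrow> real) set" where
  "bounded_cochains G n = {f.
     (\<forall>xs. xs \<notin> tuples G n \<longrightarrow> f xs = 0) \<and>
     (\<exists>B. \<forall>xs \<in> tuples G n. \<bar>f xs\<bar> \<le> B) \<and>
     (\<forall>g \<in> carrier G. \<forall>xs \<in> tuples G n. f (map (\<lambda>x. g \<otimes>\<^bsub>G\<^esub> x) xs) = f xs)}"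

definition coboundary ::
    "('a, 'b) monoid_scheme \<Rightarrow> nat \<Rightarrow> ('a list \<Rightarrow> real) \<Rightarrow> 'a list \<Rightarrow> real" where
  "coboundary G n f xs =
     (if xs \<in> tuples G (Suc n)
      then \<Sum>i = 0..Suc n. (- 1) ^ i * f (take i xs @ drop (Suc i) xs) else 0)"

definition bounded_cocycles :: "('a, 'b) monoid_scheme \<Rightarrow> nat \<Rightarrow> ('a list \<Rightarrow> real) set" where
  "bounded_cocycles G n = {f \<in> bounded_cochains G n. coboundary G n f = (\<lambda>_. 0)}"

definition bounded_coboundaries :: "('a, 'b) monoid_scheme \<Rightarrow> nat \<Rightarrow> ('a list \<Rightarrow> real) set" where
  "bounded_coboundaries G n =
     (case n of 0 \<Rightarrow> {\<lambda>_. 0} | Suc k \<Rightarrow> coboundary G k ` bounded_cochains G k)"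

definition cocycle_group :: "('a, 'b) monoid_scheme \<Rightarrow> nat \<Rightarrow> ('a list \<Rightarrow> real) monoid" where
  "cocycle_group G n =
     \<lparr>carrier = bounded_cocycles G n, monoid.mult = (\<lambda>f g xs. f xs + g xs), monoid.one = (\<lambda>_. 0)\<rparr>"

text \<open>
  Classes are cosets, i.e. sets of cocycles; the representatives of a class are its elements and
  the zero class is \<open>\<one>\<close>. Only the additive structure of the real vector space is recorded.
\<close>

definition bounded_cohomology ::
    "('a, 'b) monoid_scheme \<Rightarrow> nat \<Rightarrow> ('a list \<Rightarrow> real) set monoid" where
  "bounded_cohomology G n = cocycle_group G n Mod bounded_coboundaries G n"

definition cohomology_class ::
    "('a, 'b) monoid_scheme \<Rightarrow> nat \<Rightarrow> ('a list \<Rightarrow> real) \<Rightarrow> ('a list \<Rightarrow> real) set" where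
  "cohomology_class G n f = bounded_coboundaries G n #>\<^bsub>cocycle_group G n\<^esub> f"

definition cup_cochain ::
    "('a, 'b) monoid_scheme \<Rightarrow> nat \<Rightarrow> nat \<Rightarrow> ('a list \<Rightarrow> real) \<Rightarrow> ('a list \<Rightarrow> real) \<Rightarrow>
     'a list \<Rightarrow> real" where
  "cup_cochain G p q f g xs =
     (if xs \<in> tuples G (p + q) then f (take (Suc p) xs) * g (drop p xs) else 0)"

text \<open>
  The class of the cup product of representatives does not depend on their choice, so all the
  cosets in the following union coincide.
\<close>

definition cup_product ::
    "('a, 'b) monoid_scheme \<Rightarrow> nat \<Rightarrow> nat \<Rightarrow>
     ('a list \<Rightarrow> real) set \<Rightarrow> ('a list \<Rightarrow> real) set \<Rightarrow> ('a list \<Rightarrow> real) set" where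
  "cup_product G p q \<alpha> \<beta> =
     (\<Union>f \<in> \<alpha>. \<Union>g \<in> \<beta>. cohomology_class G (p + q) (cup_cochain G p q f g))"

text \<open>
  The arguments \<open>p\<close>, \<open>k\<close>, \<open>q\<close> are the degrees of the three classes; because of the truncated
  subtraction the definition is meaningful only for \<open>p + k \<ge> 1\<close> and \<open>k + q \<ge> 1\<close>. If one of the
  cup products of neighbours does not vanish, the set is empty.
\<close>

definition massey_product ::
    "('a, 'b) monoid_scheme \<Rightarrow> nat \<Rightarrow> nat \<Rightarrow> nat \<Rightarrow>
     ('a list \<Rightarrow> real) set \<Rightarrow> ('a list \<Rightarrow> real) set \<Rightarrow> ('a list \<Rightarrow> real) set \<Rightarrow>
     ('a list \<Rightarrow> real) set set" where
  "massey_product G p k q \<alpha>\<^sub>1 \<alpha> \<alpha>\<^sub>2 =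
     {cohomology_class G (p + q + k - 1)
        (\<lambda>xs. (- 1) ^ k *
           ((- 1) ^ p * cup_cochain G p (k + q - 1) \<omega>\<^sub>1 \<beta>\<^sub>2 xs
            - cup_cochain G (p + k - 1) q \<beta>\<^sub>1 \<omega>\<^sub>2 xs)) | \<omega>\<^sub>1 \<omega> \<omega>\<^sub>2 \<beta>\<^sub>1 \<beta>\<^sub>2.
      \<omega>\<^sub>1 \<in> \<alpha>\<^sub>1 \<and> \<omega> \<in> \<alpha> \<and> \<omega>\<^sub>2 \<in> \<alpha>\<^sub>2 \<and>
      \<beta>\<^sub>1 \<in> bounded_cochains G (p + k - 1) \<and>
      coboundary G (p + k - 1) \<beta>\<^sub>1 = cup_cochain G p k \<omega>\<^sub>1 \<omega> \<and>
      \<beta>\<^sub>2 \<in> bounded_cochains G (k + q - 1) \<and>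
      coboundary G (k + q - 1) \<beta>\<^sub>2 = cup_cochain G k q \<omega> \<omega>\<^sub>2}"


section \<open>Quasimorphisms\<close>

definition quasimorphism :: "('a, 'b) monoid_scheme \<Rightarrow> ('a \<Rightarrow> real) \<Rightarrow> bool" where
  "quasimorphism G \<phi> \<longleftrightarrow>
     bdd_above {\<bar>\<phi> g + \<phi> h - \<phi> (g \<otimes>\<^bsub>G\<^esub> h)\<bar> | g h. g \<in> carrier G \<and> h \<in> carrier G}"

definition hat :: "('a, 'b) monoid_scheme \<Rightarrow> ('a \<Rightarrow> real) \<Rightarrow> 'a list \<Rightarrow> real" where
  "hat G \<phi> xs = (if xs \<in> tuples G 1 then \<phi> (inv\<^bsub>G\<^esub> (xs ! 0) \<otimes>\<^bsub>G\<^esub> xs ! 1) else 0)"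

definition quasimorphism_class ::
    "('a, 'b) monoid_scheme \<Rightarrow> ('a \<Rightarrow> real) \<Rightarrow> ('a list \<Rightarrow> real) set" where
  "quasimorphism_class G \<phi> = cohomology_class G 2 (coboundary G 1 (hat G \<phi>))"


section \<open>Decompositions of a free group\<close>

definition symmetric_subset :: "('a, 'b) monoid_scheme \<Rightarrow> 'a set \<Rightarrow> bool" where
  "symmetric_subset G A \<longleftrightarrow> A \<subseteq> carrier G \<and> (\<forall>a \<in> A. inv\<^bsub>G\<^esub> a \<in> A)"

definition seq_inv :: "('a, 'b) monoid_scheme \<Rightarrow> 'a list \<Rightarrow> 'a list" where
  "seq_inv G s = rev (map (\<lambda>a. inv\<^bsub>G\<^esub> a) s)"

text \<open>
  The common sequence of two sequences is their \<^const>\<open>longest_common_prefix\<close>. In the last clause,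
  \<open>d\<^sub>i\<close> is the inverse of \<open>c\<^sub>i\<close>, and the factorisations determine \<open>r\<^sub>1\<close>, \<open>r\<^sub>2\<close>, \<open>r\<^sub>3\<close> uniquely. They
  exist by the preceding clauses: the common sequences at the two ends of, say, \<open>\<Delta> g\<close> cannot
  overlap, as otherwise \<open>\<Delta> h\<close> or \<open>\<Delta> (g \<otimes> h)\<close> would contain a cancellation.
\<close>

definition decomposition ::
    "('a, 'b) monoid_scheme \<Rightarrow> 'a set \<Rightarrow> 'a set \<Rightarrow> ('a \<Rightarrow> 'a list) \<Rightarrow> bool" where
  "decomposition G S P \<Delta> \<longleftrightarrow>
     (\<forall>g \<in> carrier G. set (\<Delta> g) \<subseteq> P) \<and>
     (\<forall>g \<in> carrier G. reduced_word G S g = concat (map (reduced_word G S) (\<Delta> g))) \<and>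
     (\<forall>g \<in> carrier G. \<Delta> (inv\<^bsub>G\<^esub> g) = seq_inv G (\<Delta> g)) \<and>
     (\<forall>g \<in> carrier G. \<forall>i j. i \<le> j \<and> j < length (\<Delta> g) \<longrightarrow>
        (let s = map (\<lambda>k. \<Delta> g ! k) [i..<Suc j] in \<Delta> (group_prod G s) = s)) \<and>
     (\<exists>R::nat. \<forall>g \<in> carrier G. \<forall>h \<in> carrier G.
        let gh = g \<otimes>\<^bsub>G\<^esub> h;
            d\<^sub>1 = longest_common_prefix (\<Delta> g) (\<Delta> gh);
            d\<^sub>2 = longest_common_prefix (\<Delta> (inv\<^bsub>G\<^esub> g)) (\<Delta> h);
            d\<^sub>3 = longest_common_prefix (\<Delta> (inv\<^bsub>G\<^esub> h)) (\<Delta> (inv\<^bsub>G\<^esub> gh))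
        in \<forall>r\<^sub>1 \<in> lists P. \<forall>r\<^sub>2 \<in> lists P. \<forall>r\<^sub>3 \<in> lists P.
             \<Delta> g = d\<^sub>1 @ r\<^sub>1 @ seq_inv G d\<^sub>2 \<and>
             \<Delta> h = d\<^sub>2 @ r\<^sub>2 @ seq_inv G d\<^sub>3 \<and>
             \<Delta> gh = d\<^sub>1 @ seq_inv G r\<^sub>3 @ seq_inv G d\<^sub>3 \<longrightarrow>
             length r\<^sub>1 \<le> R \<and> length r\<^sub>2 \<le> R \<and> length r\<^sub>3 \<le> R)"

definition decomposable :: "('a \<Rightarrow> real) \<Rightarrow> ('a \<Rightarrow> 'a list) \<Rightarrow> 'a \<Rightarrow> real" where
  "decomposable l \<Delta> g = (\<Sum>p\<leftarrow>\<Delta> g. l p)"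

end

theory Submission
  imports Defs
begin

text \<open>
  Write \<open>\<phi> = decomposable l \<Delta>\<close>. A function \<open>f\<close> on \<open>F\<close> is integrated along the path of pieces from
  \<open>a\<close> to \<open>b\<close>: every piece \<open>p\<close> of \<open>a\<inverse> b\<close> contributes \<open>l p\<close> times the mean of the values of \<open>f\<close> at the two
  ends of the piece. The mean makes the integral change sign when the path is reversed, so on a
  geodesic triangle everything cancels except for the at most \<open>3 R\<close> pieces in the middle: the integral
  of a bounded function over a triangle is uniformly bounded. For \<open>f = 1\<close> this says that \<open>\<phi>\<close> is a
  quasimorphism.

  For cochains \<open>f\<close>, \<open>g\<close> of degrees \<open>n\<close>, \<open>m\<close> let \<open>K f g\<close> send \<open>(x\<^sub>0, \<dots>, x\<^bsub>n+m-1\<^esub>)\<close> to the integral of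
  \<open>y \<mapsto> f (x\<^sub>0, \<dots>, x\<^bsub>n-1\<^esub>, y) g (y, x\<^sub>n, \<dots>, x\<^bsub>n+m-1\<^esub>)\<close> from \<open>x\<^bsub>n-1\<^esub>\<close> to \<open>x\<^sub>n\<close>. If \<open>f\<close> and \<open>g\<close> are cocycles, then up to
  such triangle terms, hence up to bounded cochains,
  \<open>\<delta> (K f g) = (-1)\<^sup>n (f \<union> K 1 g + K f 1 \<union> g)\<close>, where \<open>1\<close> is the constant 1-cochain.
  In the same way \<open>\<delta> (K f 1) = (-1)\<^sup>n f \<union> K 1 1\<close> and \<open>\<delta> (K 1 g) = - K 1 1 \<union> g\<close>, where \<open>K 1 1\<close> is the
  cochain \<open>(x, y) \<mapsto> \<phi> (x\<inverse> y)\<close>. The last two identities turn the unbounded primitives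
  \<open>(-1)\<^sup>n \<omega>\<^sub>1 \<union> K 1 1\<close> and \<open>K 1 1 \<union> \<omega>\<^sub>2\<close> of the two cup products into bounded ones. For these the Massey
  representative is the coboundary of \<open>\<omega>\<^sub>1 \<union> K 1 \<omega>\<^sub>2 + K \<omega>\<^sub>1 1 \<union> \<omega>\<^sub>2\<close>, which by the first identity differs
  from the cocycle \<open>(-1)\<^sup>n \<delta> (K \<omega>\<^sub>1 \<omega>\<^sub>2)\<close> by a bounded cochain.
\<close>

section \<open>Coboundaries and cup products\<close>

definition face :: "nat \<Rightarrow> 'a list \<Rightarrow> 'a list" where
  "face i xs = take i xs @ drop (Suc i) xs"

lemma coboundary_face:
  "xs \<in> tuples G (Suc n) \<Longrightarrow> coboundary G n f xs = (\<Sum>i\<le>Suc n. (- 1) ^ i * f (face i xs))"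
  by (simp add: coboundary_def face_def atMost_atLeast0)

lemma coboundary_outside: "xs \<notin> tuples G (Suc n) \<Longrightarrow> coboundary G n f xs = 0"
  by (simp add: coboundary_def)

lemma face_tuples: "xs \<in> tuples G (Suc n) \<Longrightarrow> i \<le> Suc n \<Longrightarrow> face i xs \<in> tuples G n"
  by (auto simp: tuples_def face_def dest: in_set_takeD in_set_dropD)

lemma take_tuples: "xs \<in> tuples G (p + q) \<Longrightarrow> take (Suc p) xs \<in> tuples G p"
  by (auto simp: tuples_def dest: in_set_takeD)

lemma drop_tuples: "xs \<in> tuples G (p + q) \<Longrightarrow> drop p xs \<in> tuples G q"
  by (auto simp: tuples_def dest: in_set_dropD)

lemma face_append1: "i < length xs \<Longrightarrow> face i (xs @ ys) = face i xs @ ys"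
  by (simp add: face_def)

lemma face_append2: "face (length xs + i) (xs @ ys) = xs @ face i ys"
  by (simp add: face_def)

lemma face_last: "face (length xs) (xs @ [y]) = xs"
  by (simp add: face_def)

lemma face_0 [simp]: "face 0 (x # xs) = xs"
  by (simp add: face_def)

lemma face_Suc [simp]: "face (Suc i) (x # xs) = x # face i xs"
  by (simp add: face_def)

lemma face_map: "face i (map h xs) = map h (face i xs)"
  by (simp add: face_def take_map drop_map)

lemma face_face: "j < i \<Longrightarrow> i < length xs \<Longrightarrow> face j (face i xs) = face (i - 1) (face j xs)"
proof (induction xs arbitrary: i j)
  case (Cons x xs)
  then obtain k where k: "i = Suc k" by (cases i) auto
  show ?case
  proof (cases j)
    case (Suc j')
    then obtain k' where "k = Suc k'" using Cons.prems k by (cases k) auto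
    then show ?thesis using Cons.IH[of j' k] Cons.prems k Suc by simp
  qed (simp add: k)
qed simp

lemma sum_atLeastAtMost_shift:
  fixes f :: "nat \<Rightarrow> real"
  shows "sum f {k..k + q} = (\<Sum>i\<le>q. f (k + i))"
  by (rule sum.reindex_bij_witness[where i = "\<lambda>i. k + i" and j = "\<lambda>i. i - k"]) auto

text \<open>The combinatorial half of \<delta> \<delta> = 0: the swap (i, j) -> (j, i - 1) matches
  the pairs with j < i with the remaining ones. It preserves \<open>t\<close> and changes i + j by
  one, hence reverses the sign.\<close>

lemma alternating_double_sum_zero:
  fixes t :: "nat \<Rightarrow> nat \<Rightarrow> real"
  assumes t: "\<And>i j. j < i \<Longrightarrow> i \<le> Suc N \<Longrightarrow> t i j = t j (i - 1)"
  shows "(\<Sum>i\<le>Suc N. \<Sum>j\<le>N. (- 1) ^ (i + j) * t i j) = 0"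
proof -
  define h where "h = (\<lambda>z. (- 1) ^ (fst z + snd z) * t (fst z) (snd z))"
  define A where "A = {z. snd z < fst z \<and> fst z \<le> Suc N}"
  define B where "B = {z. fst z \<le> snd z \<and> snd z \<le> N}"
  have eq: "{..Suc N} \<times> {..N} = A \<union> B" by (auto simp: A_def B_def)
  then have "finite (A \<union> B)" by (metis finite_SigmaI finite_atMost)
  then have fin: "finite A" "finite B" by simp_all
  have "(\<Sum>i\<le>Suc N. \<Sum>j\<le>N. (- 1) ^ (i + j) * t i j) = sum h ({..Suc N} \<times> {..N})"
    unfolding sum.cartesian_product h_def case_prod_unfold by (rule refl)
  also have "\<dots> = sum h A + sum h B"
    unfolding eq by (rule sum.union_disjoint[OF fin]) (auto simp: A_def B_def)
  also have "sum h A = (\<Sum>z\<in>B. - h z)"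
  proof (rule sum.reindex_bij_witness[where i = "\<lambda>z. (Suc (snd z), fst z)"
        and j = "\<lambda>z. (snd z, fst z - 1)"])
    fix z assume "z \<in> A"
    then have z: "snd z < fst z" "fst z \<le> Suc N" by (simp_all add: A_def)
    then have "fst z = Suc (fst z - 1)" by simp
    then have "(- 1 :: real) ^ (fst z + snd z) = - ((- 1) ^ (snd z + (fst z - 1)))"
      by (metis add.commute add_Suc_right power_Suc mult_minus1)
    then show "- h (snd z, fst z - 1) = h z"
      using t[OF z] by (simp add: h_def)
  qed (auto simp: A_def B_def prod_eq_iff)
  finally show ?thesis by (simp only: sum_negf add.left_inverse)
qed

lemma coboundary_coboundary: "coboundary G (Suc n) (coboundary G n f) = (\<lambda>_. 0)"
proof
  fix xs
  show "coboundary G (Suc n) (coboundary G n f) xs = 0"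
  proof (cases "xs \<in> tuples G (Suc (Suc n))")
    case True
    have "coboundary G (Suc n) (coboundary G n f) xs
        = (\<Sum>i\<le>Suc (Suc n). \<Sum>j\<le>Suc n. (- 1) ^ (i + j) * f (face j (face i xs)))"
      using True
      by (auto simp: coboundary_face[OF True] coboundary_face face_tuples sum_distrib_left
          power_add mult.assoc simp del: sum.atMost_Suc intro!: sum.cong)
    also have "\<dots> = 0"
    proof (rule alternating_double_sum_zero)
      fix i j :: nat assume "j < i" "i \<le> Suc (Suc n)"
      then show "f (face j (face i xs)) = f (face (i - 1) (face j xs))"
        using True by (subst face_face) (auto simp: tuples_def)
    qed
    finally show ?thesis .
  qed (simp add: coboundary_outside)
qed

lemma coboundary_lincomb:
  "coboundary G n (\<lambda>xs. a * f xs + b * g xs) = (\<lambda>xs. a * coboundary G n f xs + b * coboundary G n g xs)"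
proof
  fix xs
  show "coboundary G n (\<lambda>xs. a * f xs + b * g xs) xs = a * coboundary G n f xs + b * coboundary G n g xs"
  proof (cases "xs \<in> tuples G (Suc n)")
    case True
    show ?thesis
      unfolding coboundary_face[OF True] sum_distrib_left sum.distrib[symmetric]
      by (intro sum.cong) (simp_all add: algebra_simps)
  qed (simp add: coboundary_outside)
qed

text \<open>The Leibniz rule. Faces up to \<open>p\<close> touch only the first factor and later
  ones only the second. Each side lacks one face to be a full coboundary; the two missing terms are
  the same product of front and back with opposite signs.\<close>

lemma coboundary_cup:
  "coboundary G (p + q) (cup_cochain G p q f g) =
    (\<lambda>xs. cup_cochain G (Suc p) q (coboundary G p f) g xs
        + (- 1) ^ p * cup_cochain G p (Suc q) f (coboundary G q g) xs)"
proof
  fix xs :: "'a list"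
  show "coboundary G (p + q) (cup_cochain G p q f g) xs =
    cup_cochain G (Suc p) q (coboundary G p f) g xs
        + (- 1) ^ p * cup_cochain G p (Suc q) f (coboundary G q g) xs"
  proof (cases "xs \<in> tuples G (Suc (p + q))")
    case True
    have len: "length xs = Suc (Suc (p + q))" using True by (simp add: tuples_def)
    have tk: "take (Suc (Suc p)) xs \<in> tuples G (Suc p)"
      using take_tuples[of xs G "Suc p" q] True by simp
    have dr: "drop p xs \<in> tuples G (Suc q)" using drop_tuples[of xs G p "Suc q"] True by simp
    let ?c = "\<lambda>i. (- 1) ^ i * cup_cochain G p q f g (face i xs)"
    let ?t = "take (Suc p) xs" and ?d = "drop (Suc p) xs"
    have low: "?c i = (- 1) ^ i * f (face i (take (Suc (Suc p)) xs)) * g ?d" if "i \<le> p" for i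
    proof -
      have "face i xs = face i (take (Suc (Suc p)) xs) @ drop (Suc (Suc p)) xs"
        using face_append1[of i "take (Suc (Suc p)) xs" "drop (Suc (Suc p)) xs"] that len by simp
      moreover have "length (face i (take (Suc (Suc p)) xs)) = Suc p"
        using that len by (simp add: face_def)
      moreover have "drop p (face i xs) = ?d"
        using that len by (simp add: face_def)
      ultimately show ?thesis
        using face_tuples[OF True, of i] that by (simp add: cup_cochain_def)
    qed
    have high: "?c (Suc p + i) = (- 1) ^ (Suc p + i) * f ?t * g (face (Suc i) (drop p xs))"
      if "i \<le> q" for i
    proof -
      have "drop p (face (Suc p + i) xs) = face (Suc i) (drop p xs)"
        using that len by (simp add: face_def drop_take add.commute)
      moreover have "take (Suc p) (face (Suc p + i) xs) = ?t"
        using that len by (simp add: face_def)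
      ultimately show ?thesis
        using face_tuples[OF True, of "Suc p + i"] that
        by (simp add: cup_cochain_def)
    qed
    have "coboundary G (p + q) (cup_cochain G p q f g) xs = (\<Sum>i\<le>Suc p + q. ?c i)"
      by (simp add: coboundary_face[OF True] del: sum.atMost_Suc)
    also have "{..Suc p + q} = {..p} \<union> {Suc p..Suc p + q}" by auto
    also have "sum ?c \<dots> = sum ?c {..p} + sum ?c {Suc p..Suc p + q}"
      by (rule sum.union_disjoint) auto
    also have "sum ?c {Suc p..Suc p + q} = (\<Sum>i\<le>q. ?c (Suc p + i))"
      by (rule sum_atLeastAtMost_shift)
    also have "\<dots> = (\<Sum>i\<le>q. (- 1) ^ (Suc p + i) * f ?t * g (face (Suc i) (drop p xs)))"
      by (intro sum.cong) (simp_all only: high atMost_iff)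
    also have "sum ?c {..p} = (\<Sum>i\<le>p. (- 1) ^ i * f (face i (take (Suc (Suc p)) xs))) * g ?d"
      unfolding sum_distrib_right by (intro sum.cong) (simp_all only: low atMost_iff)
    also have "(\<Sum>i\<le>p. (- 1) ^ i * f (face i (take (Suc (Suc p)) xs)))
        = coboundary G p f (take (Suc (Suc p)) xs) + (- 1) ^ p * f ?t"
    proof -
      have "face (Suc p) (take (Suc (Suc p)) xs) = ?t" using len by (simp add: face_def)
      then show ?thesis by (simp add: coboundary_face[OF tk])
    qed
    also have "(\<Sum>i\<le>q. (- 1) ^ (Suc p + i) * f ?t * g (face (Suc i) (drop p xs)))
       = (- 1) ^ p * f ?t * (coboundary G q g (drop p xs) - g ?d)"
    proof -
      have "coboundary G q g (drop p xs)
          = g ?d + (\<Sum>i\<le>q. (- 1) ^ Suc i * g (face (Suc i) (drop p xs)))"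
        unfolding coboundary_face[OF dr] sum.atMost_Suc_shift by (simp add: face_def)
      then show ?thesis
        by (simp add: sum_distrib_left power_add sum_negf mult.assoc mult.left_commute)
    qed
    finally have *: "coboundary G (p + q) (cup_cochain G p q f g) xs
      = (coboundary G p f (take (Suc (Suc p)) xs) + (- 1) ^ p * f ?t) * g ?d
        + (- 1) ^ p * f ?t * (coboundary G q g (drop p xs) - g ?d)" .
    show ?thesis
      unfolding * using True by (simp add: cup_cochain_def algebra_simps)
  qed (simp add: coboundary_outside cup_cochain_def)
qed

lemma cup_cochain_assoc:
  "cup_cochain G (p + q) r (cup_cochain G p q f g) h = cup_cochain G p (q + r) f (cup_cochain G q r g h)"
proof
  fix xs :: "'a list"
  have "take (Suc p) (take (Suc (p + q)) xs) = take (Suc p) xs"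
    "drop p (take (Suc (p + q)) xs) = take (Suc q) (drop p xs)"
    "drop q (drop p xs) = drop (p + q) xs"
    by (simp_all add: drop_take min_def add.commute)
  then show "cup_cochain G (p + q) r (cup_cochain G p q f g) h xs
      = cup_cochain G p (q + r) f (cup_cochain G q r g h) xs"
    using take_tuples[of xs G "p + q" r] drop_tuples[of xs G p "q + r"]
    by (auto simp: cup_cochain_def add.assoc)
qed

lemma coboundary_cup_cocycle_left:
  assumes "coboundary G p f = (\<lambda>_. 0)"
  shows "coboundary G (p + q) (cup_cochain G p q f g) =
    (\<lambda>xs. (- 1) ^ p * cup_cochain G p (Suc q) f (coboundary G q g) xs)"
  unfolding coboundary_cup assms by (auto simp: cup_cochain_def)

lemma coboundary_cup_cocycle_right:
  assumes "coboundary G q g = (\<lambda>_. 0)"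
  shows "coboundary G (p + q) (cup_cochain G p q f g) =
    cup_cochain G (Suc p) q (coboundary G p f) g"
  unfolding coboundary_cup assms by (auto simp: cup_cochain_def)

lemma cup_cochain_lincomb_left:
  "cup_cochain G p q (\<lambda>xs. a * f xs + b * g xs) h
    = (\<lambda>xs. a * cup_cochain G p q f h xs + b * cup_cochain G p q g h xs)"
  by (auto simp: cup_cochain_def algebra_simps)

lemma cup_cochain_lincomb_right:
  "cup_cochain G p q h (\<lambda>xs. a * f xs + b * g xs)
    = (\<lambda>xs. a * cup_cochain G p q h f xs + b * cup_cochain G p q h g xs)"
  by (auto simp: cup_cochain_def algebra_simps)

lemma cup_cochain_zero [simp]:
  "cup_cochain G p q (\<lambda>_. 0) h = (\<lambda>_. 0)" "cup_cochain G p q h (\<lambda>_. 0) = (\<lambda>_. 0)"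
  by (auto simp: cup_cochain_def)

lemma cup_cochain_cmult_left:
  "cup_cochain G p q (\<lambda>xs. c * f xs) h = (\<lambda>xs. c * cup_cochain G p q f h xs)"
  using cup_cochain_lincomb_left[of G p q c f 0 f h] by simp

lemma coboundary_cmult: "coboundary G n (\<lambda>xs. c * f xs) = (\<lambda>xs. c * coboundary G n f xs)"
  using coboundary_lincomb[of G n c f 0 f] by simp

text \<open>The homotopies and the cochain of \<phi> are invariant but in general unbounded, so
  invariance has to be tracked separately from boundedness.\<close>

definition invariant_cochains :: "('a, 'b) monoid_scheme \<Rightarrow> nat \<Rightarrow> ('a list \<Rightarrow> real) set" where
  "invariant_cochains G n = {f.
     (\<forall>xs. xs \<notin> tuples G n \<longrightarrow> f xs = 0) \<and>
     (\<forall>g \<in> carrier G. \<forall>xs \<in> tuples G n. f (map (\<lambda>x. g \<otimes>\<^bsub>G\<^esub> x) xs) = f xs)}"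

lemma invariant_cochainsD:
  "f \<in> invariant_cochains G n \<Longrightarrow> g \<in> carrier G \<Longrightarrow> xs \<in> tuples G n \<Longrightarrow>
    f (map (\<lambda>x. g \<otimes>\<^bsub>G\<^esub> x) xs) = f xs"
  by (simp add: invariant_cochains_def)

lemma bounded_cochains_iff:
  "f \<in> bounded_cochains G n \<longleftrightarrow>
    f \<in> invariant_cochains G n \<and> (\<exists>B. \<forall>xs \<in> tuples G n. \<bar>f xs\<bar> \<le> B)"
  by (auto simp: bounded_cochains_def invariant_cochains_def)

lemma invariant_cochains_lincomb:
  "f \<in> invariant_cochains G n \<Longrightarrow> g \<in> invariant_cochains G n \<Longrightarrow>
    (\<lambda>xs. a * f xs + b * g xs) \<in> invariant_cochains G n"
  by (simp add: invariant_cochains_def)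

lemma bounded_cochains_lincomb:
  assumes "f \<in> bounded_cochains G n" "g \<in> bounded_cochains G n"
  shows "(\<lambda>xs. a * f xs + b * g xs) \<in> bounded_cochains G n"
proof -
  obtain B C where "\<forall>xs \<in> tuples G n. \<bar>f xs\<bar> \<le> B" "\<forall>xs \<in> tuples G n. \<bar>g xs\<bar> \<le> C"
    using assms by (auto simp: bounded_cochains_iff)
  then have "\<bar>a * f xs + b * g xs\<bar> \<le> \<bar>a\<bar> * B + \<bar>b\<bar> * C" if "xs \<in> tuples G n" for xs
    using that by (intro order.trans[OF abs_triangle_ineq])
      (auto simp: abs_mult intro!: add_mono mult_left_mono)
  then show ?thesis
    using assms by (auto simp: bounded_cochains_iff invariant_cochains_lincomb)
qed

lemma zero_bounded_cochain: "(\<lambda>_. 0) \<in> bounded_cochains G n"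
  by (auto simp: bounded_cochains_def)

lemma zero_invariant_cochain: "(\<lambda>_. 0) \<in> invariant_cochains G n"
  using zero_bounded_cochain by (auto simp: bounded_cochains_iff)

lemma bounded_cocycleD:
  assumes "f \<in> bounded_cocycles G n"
  shows "f \<in> bounded_cochains G n" "coboundary G n f = (\<lambda>_. 0)"
  using assms by (auto simp: bounded_cocycles_def)

context group
begin

lemma map_tuples: "g \<in> carrier G \<Longrightarrow> xs \<in> tuples G n \<Longrightarrow> map (\<lambda>x. g \<otimes> x) xs \<in> tuples G n"
  by (auto simp: tuples_def)

lemma coboundary_invariant:
  assumes "f \<in> invariant_cochains G n"
  shows "coboundary G n f \<in> invariant_cochains G (Suc n)"
  using assms
  by (auto simp: invariant_cochains_def coboundary_outside coboundary_face map_tuples face_map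
      face_tuples simp del: sum.atMost_Suc intro!: sum.cong)

lemma coboundary_bounded:
  assumes f: "f \<in> bounded_cochains G n"
  shows "coboundary G n f \<in> bounded_cochains G (Suc n)"
proof -
  obtain B where B: "\<And>xs. xs \<in> tuples G n \<Longrightarrow> \<bar>f xs\<bar> \<le> B"
    using f by (auto simp: bounded_cochains_iff)
  have "\<bar>coboundary G n f xs\<bar> \<le> (\<Sum>i\<le>Suc n. B)" if xs: "xs \<in> tuples G (Suc n)" for xs
    unfolding coboundary_face[OF xs]
    by (intro order.trans[OF sum_abs] sum_mono)
      (auto simp: abs_mult power_abs intro!: B face_tuples[OF xs])
  then show ?thesis
    using f coboundary_invariant[of f n] by (auto simp: bounded_cochains_iff simp del: sum_constant)
qed

lemma cup_invariant:
  assumes "f \<in> invariant_cochains G p" "g \<in> invariant_cochains G q"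
  shows "cup_cochain G p q f g \<in> invariant_cochains G (p + q)"
  using assms
  by (auto simp: invariant_cochains_def cup_cochain_def map_tuples take_map drop_map
      take_tuples drop_tuples)

lemma cup_bounded:
  assumes f: "f \<in> bounded_cochains G p" and g: "g \<in> bounded_cochains G q"
  shows "cup_cochain G p q f g \<in> bounded_cochains G (p + q)"
proof -
  obtain B C where B: "\<And>xs. xs \<in> tuples G p \<Longrightarrow> \<bar>f xs\<bar> \<le> B"
    and C: "\<And>xs. xs \<in> tuples G q \<Longrightarrow> \<bar>g xs\<bar> \<le> C"
    using f g unfolding bounded_cochains_iff by blast
  have "\<bar>cup_cochain G p q f g xs\<bar> \<le> B * C" if "xs \<in> tuples G (p + q)" for xs
    using B[OF take_tuples[OF that]] C[OF drop_tuples[OF that]] that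
    by (auto simp: cup_cochain_def abs_mult intro!: mult_mono)
  then show ?thesis
    using f g cup_invariant by (auto simp: bounded_cochains_iff)
qed

section \<open>Classes as cosets of bounded coboundaries\<close>

lemma cohomology_class_coboundary:
  assumes f: "f \<in> bounded_cochains G n"
  shows "cohomology_class G (Suc n) (coboundary G n f) = bounded_coboundaries G (Suc n)"
proof -
  \<comment> \<open>\<open>c = 1\<close> serves the inclusion of the coset in the coboundaries,
    \<open>c = -1\<close> the converse.\<close>
  have 1: "(\<lambda>xs. coboundary G n h xs + c * coboundary G n f xs) \<in> bounded_coboundaries G (Suc n)"
    if "h \<in> bounded_cochains G n" for h c
    using bounded_cochains_lincomb[OF that f, of 1 c] coboundary_lincomb[of G n 1 h c f]
    by (simp add: bounded_coboundaries_def) (metis image_eqI)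
  show ?thesis
  proof (intro equalityI subsetI)
    fix u assume "u \<in> cohomology_class G (Suc n) (coboundary G n f)"
    then show "u \<in> bounded_coboundaries G (Suc n)"
      using 1[of _ 1]
      by (auto simp: cohomology_class_def r_coset_def cocycle_group_def bounded_coboundaries_def)
  next
    fix u assume "u \<in> bounded_coboundaries G (Suc n)"
    then obtain h where h: "h \<in> bounded_cochains G n" "u = coboundary G n h"
      by (auto simp: bounded_coboundaries_def)
    show "u \<in> cohomology_class G (Suc n) (coboundary G n f)"
      unfolding cohomology_class_def r_coset_def cocycle_group_def
      using 1[OF h(1), of "-1"] h(2) by (auto simp: fun_eq_iff intro!: bexI)
  qed
qed

lemma bounded_cohomology_one:
  "\<one>\<^bsub>bounded_cohomology G n\<^esub> = bounded_coboundaries G n"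
  by (simp add: bounded_cohomology_def FactGroup_def)

text \<open>Nonemptiness keeps the union in \<open>cup_product\<close> from being empty. All
  representatives are cocycles because \<delta> \<delta> = 0.\<close>

lemma bounded_cohomology_classD:
  assumes "\<alpha> \<in> carrier (bounded_cohomology G (Suc n))"
  shows "\<alpha> \<subseteq> bounded_cocycles G (Suc n)" "\<alpha> \<noteq> {}"
proof -
  obtain z where z: "z \<in> bounded_cocycles G (Suc n)"
    and \<alpha>: "\<alpha> = {\<lambda>xs. coboundary G n h xs + z xs | h. h \<in> bounded_cochains G n}"
    using assms
    by (auto simp: bounded_cohomology_def FactGroup_def RCOSETS_def r_coset_def cocycle_group_def
        bounded_coboundaries_def)
  show "\<alpha> \<noteq> {}" unfolding \<alpha> using zero_bounded_cochain by blast
  show "\<alpha> \<subseteq> bounded_cocycles G (Suc n)"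
  proof
    fix u assume "u \<in> \<alpha>"
    then obtain h where h: "h \<in> bounded_cochains G n" "u = (\<lambda>xs. coboundary G n h xs + z xs)"
      unfolding \<alpha> by blast
    then show "u \<in> bounded_cocycles G (Suc n)"
      using bounded_cochains_lincomb[OF coboundary_bounded[OF h(1)] bounded_cocycleD(1)[OF z], of 1 1]
        coboundary_lincomb[of G "Suc n" 1 "coboundary G n h" 1 z] bounded_cocycleD(2)[OF z]
      by (simp add: bounded_cocycles_def coboundary_coboundary)
  qed
qed

lemma cohomology_classE:
  assumes "u \<in> cohomology_class G (Suc n) z"
  obtains h where "h \<in> bounded_cochains G n" "u = (\<lambda>xs. coboundary G n h xs + z xs)"
  using assms
  by (auto simp: cohomology_class_def r_coset_def cocycle_group_def bounded_coboundaries_def)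

lemma cohomology_class_self: "z \<in> cohomology_class G (Suc n) z"
  \<comment> \<open>With both coefficients 0, linearity says that the coboundary of 0 is 0, so
    \<open>z\<close> itself lies in its coset.\<close>
  using zero_bounded_cochain[of G n] coboundary_lincomb[of G n 0 z 0 z]
  by (force simp: cohomology_class_def r_coset_def cocycle_group_def bounded_coboundaries_def)

end

section \<open>Integration along decompositions\<close>

context monoid
begin

lemma group_prod_Nil [simp]: "group_prod G [] = \<one>"
  by (simp add: group_prod_def)

lemma group_prod_Cons [simp]: "group_prod G (x # xs) = x \<otimes> group_prod G xs"
  by (simp add: group_prod_def)

lemma group_prod_closed [simp]: "set xs \<subseteq> carrier G \<Longrightarrow> group_prod G xs \<in> carrier G"
  by (induction xs) auto

lemma group_prod_append:
  "set xs \<subseteq> carrier G \<Longrightarrow> set ys \<subseteq> carrier G \<Longrightarrow>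
    group_prod G (xs @ ys) = group_prod G xs \<otimes> group_prod G ys"
  by (induction xs) (auto simp: m_assoc)

end

lemma seq_inv_Nil [simp]: "seq_inv G [] = []"
  by (simp add: seq_inv_def)

lemma seq_inv_Cons [simp]: "seq_inv G (x # xs) = seq_inv G xs @ [inv\<^bsub>G\<^esub> x]"
  by (simp add: seq_inv_def)

lemma seq_inv_append [simp]: "seq_inv G (xs @ ys) = seq_inv G ys @ seq_inv G xs"
  by (simp add: seq_inv_def)

lemma length_seq_inv [simp]: "length (seq_inv G xs) = length xs"
  by (simp add: seq_inv_def)

context group
begin

lemma seq_inv_closed: "set xs \<subseteq> carrier G \<Longrightarrow> set (seq_inv G xs) \<subseteq> carrier G"
  by (auto simp: seq_inv_def)

lemma seq_inv_seq_inv: "set xs \<subseteq> carrier G \<Longrightarrow> seq_inv G (seq_inv G xs) = xs"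
  by (induction xs) auto

lemma group_prod_seq_inv:
  "set xs \<subseteq> carrier G \<Longrightarrow> group_prod G (seq_inv G xs) = inv (group_prod G xs)"
  by (induction xs) (auto simp: group_prod_append seq_inv_closed inv_mult_group)

text \<open>Inverting turns the second prefix into a suffix of \<open>s\<close>, and the length
  bound keeps it disjoint from \<open>d\<close>. This yields the factorisations that the last clause
  of \<open>decomposition\<close> presupposes.\<close>

lemma prefix_suffix_split:
  assumes "prefix d s" "prefix e (seq_inv G s)" "length d + length e \<le> length s"
    and s: "set s \<subseteq> carrier G"
  obtains r where "s = d @ r @ seq_inv G e"
proof -
  obtain s' e' where s': "s = d @ s'" and e': "seq_inv G s = e @ e'"
    using assms by (auto simp: prefix_def)
  then have "d @ s' = seq_inv G e' @ seq_inv G e"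
    by (metis s seq_inv_seq_inv seq_inv_append)
  moreover have "length d \<le> length (seq_inv G e')"
    using assms(3) arg_cong[OF e', of length] by simp
  ultimately obtain r where "d @ r = seq_inv G e'" "s' = r @ seq_inv G e"
    by (auto simp: append_eq_append_conv2)
  then show thesis using that[of r] s' by simp
qed

end

lemma longest_common_prefix_commute: "longest_common_prefix xs ys = longest_common_prefix ys xs"
  by (induction xs ys rule: longest_common_prefix.induct) auto

section \<open>Weighted path sums and the data they depend on\<close>

fun path_sum :: "('a, 'b) monoid_scheme \<Rightarrow> ('a \<Rightarrow> real) \<Rightarrow> ('a \<Rightarrow> real) \<Rightarrow> 'a \<Rightarrow> 'a list \<Rightarrow> real" where
  "path_sum G l f a [] = 0"
| "path_sum G l f a (p # ps) =
    l p * ((f a + f (a \<otimes>\<^bsub>G\<^esub> p)) / 2) + path_sum G l f (a \<otimes>\<^bsub>G\<^esub> p) ps"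

lemma path_sum_one: "path_sum G l (\<lambda>_. 1) a ps = (\<Sum>p\<leftarrow>ps. l p)"
  by (induction ps arbitrary: a) auto

lemma path_sum_add: "path_sum G l (\<lambda>y. f y + g y) a ps = path_sum G l f a ps + path_sum G l g a ps"
  by (induction ps arbitrary: a) (auto simp: field_simps)

lemma path_sum_cmult: "path_sum G l (\<lambda>y. c * f y) a ps = c * path_sum G l f a ps"
  by (induction ps arbitrary: a) (auto simp: field_simps)

text \<open>The data that integration uses. Reduced words act only through
  \<open>prod_\<Delta>\<close> and through the empty infix allowed in \<open>\<Delta>_infix\<close>,
  which forces \<open>\<Delta> \<one> = []\<close>. \<open>R\<close> is the constant of the triangle
  clause.\<close>

locale weighted_decomposition = group G for G (structure) +
  fixes P :: "'a set" and \<Delta> :: "'a \<Rightarrow> 'a list" and R :: nat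
    and l :: "'a \<Rightarrow> real" and B :: real
  assumes B_nonneg: "0 \<le> B"
    and P_carrier: "P \<subseteq> carrier G"
    and P_inv: "p \<in> P \<Longrightarrow> inv p \<in> P"
    and \<Delta>_pieces: "g \<in> carrier G \<Longrightarrow> set (\<Delta> g) \<subseteq> P"
    and prod_\<Delta>: "g \<in> carrier G \<Longrightarrow> group_prod G (\<Delta> g) = g"
    and \<Delta>_inv: "g \<in> carrier G \<Longrightarrow> \<Delta> (inv g) = seq_inv G (\<Delta> g)"
    and \<Delta>_infix: "g \<in> carrier G \<Longrightarrow> \<Delta> g = xs @ ys @ zs \<Longrightarrow> \<Delta> (group_prod G ys) = ys"
    and \<Delta>_triangle: "\<lbrakk>g \<in> carrier G; h \<in> carrier G;
      d\<^sub>1 = longest_common_prefix (\<Delta> g) (\<Delta> (g \<otimes> h));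
      d\<^sub>2 = longest_common_prefix (\<Delta> (inv g)) (\<Delta> h);
      d\<^sub>3 = longest_common_prefix (\<Delta> (inv h)) (\<Delta> (inv (g \<otimes> h)));
      set r\<^sub>1 \<subseteq> P; set r\<^sub>2 \<subseteq> P; set r\<^sub>3 \<subseteq> P;
      \<Delta> g = d\<^sub>1 @ r\<^sub>1 @ seq_inv G d\<^sub>2; \<Delta> h = d\<^sub>2 @ r\<^sub>2 @ seq_inv G d\<^sub>3;
      \<Delta> (g \<otimes> h) = d\<^sub>1 @ seq_inv G r\<^sub>3 @ seq_inv G d\<^sub>3\<rbrakk>
      \<Longrightarrow> length r\<^sub>1 \<le> R \<and> length r\<^sub>2 \<le> R \<and> length r\<^sub>3 \<le> R"
    and weight_bound: "p \<in> P \<Longrightarrow> \<bar>l p\<bar> \<le> B"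
    and weight_inv: "p \<in> P \<Longrightarrow> l (inv p) = - l p"
begin

section \<open>Triangles as tripods with a bounded core\<close>

lemma \<Delta>_carrier: "g \<in> carrier G \<Longrightarrow> set (\<Delta> g) \<subseteq> carrier G"
  using \<Delta>_pieces P_carrier by blast

lemma seq_inv_pieces: "set xs \<subseteq> P \<Longrightarrow> set (seq_inv G xs) \<subseteq> P"
  by (auto simp: seq_inv_def P_inv)

text \<open>By \<open>\<Delta>_infix\<close> the two pieces would form the decomposition of their
  product \<one>, but that decomposition is empty.\<close>

lemma no_cancellation:
  assumes g: "g \<in> carrier G" and eq: "\<Delta> g = xs @ [p, inv p] @ zs"
  shows False
proof -
  have "p \<in> carrier G" using \<Delta>_carrier[OF g] eq by auto
  then have "\<Delta> \<one> = [p, inv p]" using \<Delta>_infix[OF g eq] by simp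
  moreover have "\<Delta> \<one> = []" using \<Delta>_infix[OF g, of "[]" "[]"] by simp
  ultimately show False by simp
qed

text \<open>
  If the two common sequences overlapped, then \<open>\<Delta> (g \<otimes> h)\<close> would contain a piece followed by its
  inverse.
\<close>

lemma common_prefixes_disjoint:
  assumes g: "g \<in> carrier G" and h: "h \<in> carrier G"
  shows "length (longest_common_prefix (\<Delta> g) (\<Delta> (g \<otimes> h)))
      + length (longest_common_prefix (\<Delta> (inv g)) (\<Delta> h)) \<le> length (\<Delta> g)"
proof (rule ccontr)
  define d e where "d = longest_common_prefix (\<Delta> g) (\<Delta> (g \<otimes> h))"
    and "e = longest_common_prefix (\<Delta> (inv g)) (\<Delta> h)"
  assume "\<not> ?thesis"
  then have long: "length d + length e > length (\<Delta> g)" by (simp add: d_def e_def)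
  obtain y where y: "\<Delta> g = d @ y"
    using longest_common_prefix_prefix1 unfolding d_def prefix_def by blast
  obtain u where u: "\<Delta> (g \<otimes> h) = d @ u"
    using longest_common_prefix_prefix2 unfolding d_def prefix_def by blast
  obtain v where v: "seq_inv G (\<Delta> g) = e @ v"
    using longest_common_prefix_prefix1 \<Delta>_inv[OF g] unfolding e_def prefix_def by metis
  obtain w where w: "\<Delta> h = e @ w"
    using longest_common_prefix_prefix2 unfolding e_def prefix_def by blast
  have ly: "length y < length e" using long y by simp
  have "length e \<le> length (\<Delta> g)" using arg_cong[OF v, of length] by simp
  then have "d \<noteq> []" using long by auto
  then obtain x p where d: "d = x @ [p]" by (cases d rule: rev_cases) auto
  \<comment> \<open>The inverse of \<open>\<Delta> g\<close> starts with the inverse of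
    \<open>y\<close> followed by \<open>inv p\<close>. As \<open>e\<close> is longer than
    \<open>y\<close>, it contains this whole beginning, and so does
    \<open>\<Delta> h\<close>.\<close>
  have "prefix (seq_inv G y @ [inv p]) (e @ v)" unfolding v[symmetric] y d by simp
  then have "prefix (seq_inv G y @ [inv p]) e"
    by (rule prefix_length_prefix) (use ly in auto)
  then obtain t where t: "\<Delta> h = seq_inv G y @ inv p # t"
    using w by (auto simp: prefix_def)
  have c: "set x \<subseteq> carrier G" "p \<in> carrier G" "set y \<subseteq> carrier G" "set u \<subseteq> carrier G"
      "set t \<subseteq> carrier G"
    using \<Delta>_carrier[OF g] \<Delta>_carrier[OF h] \<Delta>_carrier[OF m_closed[OF g h]] y d u t by auto
  let ?p = "group_prod G"
  have "g = ?p x \<otimes> p \<otimes> ?p y"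
    using prod_\<Delta>[OF g] c by (simp add: y d group_prod_append m_assoc)
  moreover have "h = inv (?p y) \<otimes> (inv p \<otimes> ?p t)"
    using prod_\<Delta>[OF h] c by (simp add: t group_prod_append group_prod_seq_inv seq_inv_closed)
  ultimately have "g \<otimes> h = ?p x \<otimes> p \<otimes> ?p (inv p # t)"
    using c by (simp add: m_assoc inv_solve_left) (simp add: m_assoc[symmetric])
  moreover have "g \<otimes> h = ?p x \<otimes> p \<otimes> ?p u"
    using prod_\<Delta>[OF m_closed[OF g h]] c by (simp add: u d group_prod_append m_assoc)
  \<comment> \<open>Cancelling the common left factor compares two tails of decompositions; by
    \<open>\<Delta>_infix\<close>, tails with equal products are equal as sequences.\<close>
  ultimately have "?p (inv p # t) = ?p u"
    using c by (simp del: group_prod_Cons)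
  moreover have "\<Delta> (?p u) = u" by (rule \<Delta>_infix[of "g \<otimes> h" d u "[]"]) (use g h u in auto)
  moreover have "\<Delta> (?p (inv p # t)) = inv p # t"
    by (rule \<Delta>_infix[of h "seq_inv G y" _ "[]"]) (use h t in auto)
  ultimately have "\<Delta> (g \<otimes> h) = x @ [p, inv p] @ t"
    using u d by simp
  then show False using no_cancellation g h by blast
qed

text \<open>Each common sequence is shared by the two sides meeting at a corner, and no two of them
  overlap on a side. Hence the factorisations exist and the triangle clause bounds the middle
  parts.\<close>

lemma triangle_split:
  assumes g: "g \<in> carrier G" and h: "h \<in> carrier G"
  obtains d\<^sub>1 d\<^sub>2 d\<^sub>3 r\<^sub>1 r\<^sub>2 r\<^sub>3 where
    "\<Delta> g = d\<^sub>1 @ r\<^sub>1 @ seq_inv G d\<^sub>2" "\<Delta> h = d\<^sub>2 @ r\<^sub>2 @ seq_inv G d\<^sub>3"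
    "\<Delta> (g \<otimes> h) = d\<^sub>1 @ seq_inv G r\<^sub>3 @ seq_inv G d\<^sub>3"
    "length r\<^sub>1 \<le> R" "length r\<^sub>2 \<le> R" "length r\<^sub>3 \<le> R"
    "set r\<^sub>3 \<subseteq> P" "set d\<^sub>2 \<subseteq> P" "set d\<^sub>3 \<subseteq> P"
proof -
  let ?lcp = longest_common_prefix
  have gh: "g \<otimes> h \<in> carrier G" using g h by simp
  define d\<^sub>1 d\<^sub>2 d\<^sub>3 where d: "d\<^sub>1 = ?lcp (\<Delta> g) (\<Delta> (g \<otimes> h))" "d\<^sub>2 = ?lcp (\<Delta> (inv g)) (\<Delta> h)"
    "d\<^sub>3 = ?lcp (\<Delta> (inv h)) (\<Delta> (inv (g \<otimes> h)))"
  have p1: "prefix d\<^sub>1 (\<Delta> g)" "prefix d\<^sub>2 (seq_inv G (\<Delta> g))"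
    and p2: "prefix d\<^sub>2 (\<Delta> h)" "prefix d\<^sub>3 (seq_inv G (\<Delta> h))"
    and p3: "prefix d\<^sub>1 (\<Delta> (g \<otimes> h))" "prefix d\<^sub>3 (seq_inv G (\<Delta> (g \<otimes> h)))"
    unfolding d using g h gh
    by (metis \<Delta>_inv longest_common_prefix_prefix1 longest_common_prefix_prefix2)+
  have l1: "length d\<^sub>1 + length d\<^sub>2 \<le> length (\<Delta> g)"
    unfolding d by (rule common_prefixes_disjoint[OF g h])
  \<comment> \<open>The other two sides are treated by viewing the same triangle from the pairs
    \<open>h\<close>, \<open>inv (g \<otimes> h)\<close> and \<open>g \<otimes> h\<close>,
    \<open>inv h\<close>.\<close>
  have "h \<otimes> inv (g \<otimes> h) = inv g"
    using g h by (simp add: inv_mult_group m_assoc[symmetric])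
  then have l2: "length d\<^sub>2 + length d\<^sub>3 \<le> length (\<Delta> h)"
    unfolding d using common_prefixes_disjoint[OF h inv_closed[OF gh]] longest_common_prefix_commute
    by metis
  have "g \<otimes> h \<otimes> inv h = g" using g h by (simp add: m_assoc)
  then have l3: "length d\<^sub>1 + length d\<^sub>3 \<le> length (\<Delta> (g \<otimes> h))"
    unfolding d using common_prefixes_disjoint[OF gh inv_closed[OF h]] longest_common_prefix_commute
    by metis
  obtain r\<^sub>1 where r1: "\<Delta> g = d\<^sub>1 @ r\<^sub>1 @ seq_inv G d\<^sub>2"
    using prefix_suffix_split[OF p1 l1 \<Delta>_carrier[OF g]] .
  obtain r\<^sub>2 where r2: "\<Delta> h = d\<^sub>2 @ r\<^sub>2 @ seq_inv G d\<^sub>3"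
    using prefix_suffix_split[OF p2 l2 \<Delta>_carrier[OF h]] .
  obtain r where r: "\<Delta> (g \<otimes> h) = d\<^sub>1 @ r @ seq_inv G d\<^sub>3"
    using prefix_suffix_split[OF p3 l3 \<Delta>_carrier[OF gh]] .
  have rP: "set r \<subseteq> P" using \<Delta>_pieces[OF gh] r by auto
  \<comment> \<open>The triangle clause reads this side backwards, so its third middle part will be
    \<open>seq_inv G r\<close>.\<close>
  then have r3: "seq_inv G (seq_inv G r) = r" using P_carrier by (intro seq_inv_seq_inv) auto
  have P: "set r\<^sub>1 \<subseteq> P" "set r\<^sub>2 \<subseteq> P" "set (seq_inv G r) \<subseteq> P"
    using \<Delta>_pieces[OF g] \<Delta>_pieces[OF h] r1 r2 seq_inv_pieces[OF rP] by auto
  have "set d\<^sub>2 \<subseteq> P" using p2(1) \<Delta>_pieces[OF h] by (auto dest: set_mono_prefix)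
  moreover have "set d\<^sub>3 \<subseteq> P"
    using p2(2) seq_inv_pieces[OF \<Delta>_pieces[OF h]] by (auto dest: set_mono_prefix)
  ultimately show thesis
    using \<Delta>_triangle[OF g h d P r1 r2] that[of d\<^sub>1 r\<^sub>1 d\<^sub>2 r\<^sub>2 d\<^sub>3 "seq_inv G r"] r r1 r2 r3 P by simp
qed

section \<open>Concatenation, reversal, bounds and translation of path sums\<close>

abbreviation path where "path \<equiv> path_sum G l"

lemma path_append:
  "a \<in> carrier G \<Longrightarrow> set xs \<subseteq> carrier G \<Longrightarrow>
    path f a (xs @ ys) = path f a xs + path f (a \<otimes> group_prod G xs) ys"
  by (induction xs arbitrary: a) (auto simp: m_assoc)

text \<open>Reversing a piece swaps its ends without changing their mean, while
  \<open>weight_inv\<close> negates its weight; the latter is why the entries must be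
  pieces.\<close>

lemma path_seq_inv:
  assumes "a \<in> carrier G" "set xs \<subseteq> P"
  shows "path f (a \<otimes> group_prod G xs) (seq_inv G xs) = - path f a xs"
  using assms
proof (induction xs arbitrary: a)
  case (Cons p xs)
  have c: "p \<in> carrier G" "set xs \<subseteq> carrier G" "group_prod G xs \<in> carrier G" "p \<in> P"
    using Cons.prems P_carrier by auto
  have "a \<otimes> p \<otimes> group_prod G xs \<otimes> inv (group_prod G xs) = a \<otimes> p" "a \<otimes> p \<otimes> inv p = a"
    using Cons.prems c by (simp_all add: m_assoc)
  then show ?case
    using Cons c
    by (simp add: m_assoc[symmetric] path_append seq_inv_closed group_prod_seq_inv weight_inv
        add.commute)
qed simp

lemma path_bound:
  assumes "a \<in> carrier G" "set xs \<subseteq> P" "\<And>y. y \<in> carrier G \<Longrightarrow> \<bar>f y\<bar> \<le> C"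
  shows "\<bar>path f a xs\<bar> \<le> length xs * (B * C)"
  using assms(1,2)
proof (induction xs arbitrary: a)
  case (Cons p xs)
  then have p: "p \<in> P" "p \<in> carrier G" using P_carrier by auto
  have "\<bar>(f a + f (a \<otimes> p)) / 2\<bar> \<le> C"
    using assms(3)[of a] assms(3)[of "a \<otimes> p"] Cons.prems p by simp
  then have "\<bar>l p * ((f a + f (a \<otimes> p)) / 2)\<bar> \<le> B * C"
    unfolding abs_mult using weight_bound[OF p(1)] by (intro mult_mono) auto
  moreover have "\<bar>path f (a \<otimes> p) xs\<bar> \<le> length xs * (B * C)"
    using Cons p by simp
  ultimately show ?case
    using abs_triangle_ineq[of "l p * ((f a + f (a \<otimes> p)) / 2)" "path f (a \<otimes> p) xs"]
    by (simp add: distrib_right)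
qed simp

lemma path_cong:
  assumes "a \<in> carrier G" "set xs \<subseteq> carrier G" "\<And>y. y \<in> carrier G \<Longrightarrow> f y = f' y"
  shows "path f a xs = path f' a xs"
  using assms(1,2) by (induction xs arbitrary: a) (auto simp: assms(3))

lemma path_translate:
  assumes "g \<in> carrier G" "a \<in> carrier G" "set xs \<subseteq> carrier G"
  shows "path f (g \<otimes> a) xs = path (\<lambda>y. f (g \<otimes> y)) a xs"
  using assms by (induction xs arbitrary: a) (auto simp: m_assoc)

section \<open>Integrals between group elements\<close>

definition integral :: "('a \<Rightarrow> real) \<Rightarrow> 'a \<Rightarrow> 'a \<Rightarrow> real" where
  "integral f a b = path f a (\<Delta> (inv a \<otimes> b))"

lemma integral_one: "integral (\<lambda>_. 1) a b = decomposable l \<Delta> (inv a \<otimes> b)"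
  by (simp add: integral_def path_sum_one decomposable_def)

lemma integral_add: "integral (\<lambda>y. f y + g y) a b = integral f a b + integral g a b"
  by (simp add: integral_def path_sum_add)

lemma integral_cmult: "integral (\<lambda>y. c * f y) a b = c * integral f a b"
  by (simp add: integral_def path_sum_cmult)

lemma integral_sum: "integral (\<lambda>y. \<Sum>i\<in>I. f i y) a b = (\<Sum>i\<in>I. integral (f i) a b)"
proof (induction I rule: infinite_finite_induct)
  case (insert i I)
  then show ?case by (simp add: integral_add)
\<comment> \<open>Empty and infinite index sets need the integral of 0, obtained by scaling with
  0.\<close>
qed (use integral_cmult[of 0] in auto)

lemma integral_cong:
  assumes "a \<in> carrier G" "b \<in> carrier G" "\<And>y. y \<in> carrier G \<Longrightarrow> f y = f' y"
  shows "integral f a b = integral f' a b"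
  unfolding integral_def using assms \<Delta>_carrier by (intro path_cong) auto

lemma integral_translate:
  assumes "g \<in> carrier G" "a \<in> carrier G" "b \<in> carrier G"
  shows "integral f (g \<otimes> a) (g \<otimes> b) = integral (\<lambda>y. f (g \<otimes> y)) a b"
proof -
  have "inv (g \<otimes> a) \<otimes> (g \<otimes> b) = inv a \<otimes> b"
    using assms by (simp add: inv_mult_group m_assoc inv_solve_left')
  then show ?thesis
    unfolding integral_def using assms by (simp add: path_translate \<Delta>_carrier)
qed

text \<open>The segments at the three corners are traversed twice with opposite total sign. What
  remains are three middle paths of at most \<open>R\<close> pieces, each piece contributing at most
  \<open>B * C\<close>.\<close>

lemma integral_triangle:
  assumes "a \<in> carrier G" "b \<in> carrier G" "c \<in> carrier G"
    and C: "\<And>y. y \<in> carrier G \<Longrightarrow> \<bar>f y\<bar> \<le> C"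
  shows "\<bar>integral f a b + integral f b c - integral f a c\<bar> \<le> 3 * (R * (B * C))"
proof -
  define g h where gh: "g = inv a \<otimes> b" "h = inv b \<otimes> c"
  have g: "g \<in> carrier G" and h: "h \<in> carrier G" using assms by (auto simp: gh)
  have b: "a \<otimes> g = b" and c: "b \<otimes> h = c"
    using assms by (simp_all add: gh m_assoc[symmetric])
  then have k: "inv a \<otimes> c = g \<otimes> h"
    using assms g h by (metis gh(1) inv_closed m_assoc)
  obtain d\<^sub>1 d\<^sub>2 d\<^sub>3 r\<^sub>1 r\<^sub>2 r\<^sub>3 where
    split: "\<Delta> g = d\<^sub>1 @ r\<^sub>1 @ seq_inv G d\<^sub>2" "\<Delta> h = d\<^sub>2 @ r\<^sub>2 @ seq_inv G d\<^sub>3"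
      "\<Delta> (g \<otimes> h) = d\<^sub>1 @ seq_inv G r\<^sub>3 @ seq_inv G d\<^sub>3"
    and R: "length r\<^sub>1 \<le> R" "length r\<^sub>2 \<le> R" "length r\<^sub>3 \<le> R"
    and P: "set r\<^sub>3 \<subseteq> P" "set d\<^sub>2 \<subseteq> P" "set d\<^sub>3 \<subseteq> P"
    by (rule triangle_split[OF g h])
  have P': "set d\<^sub>1 \<subseteq> P" "set r\<^sub>1 \<subseteq> P" "set r\<^sub>2 \<subseteq> P" "set (seq_inv G r\<^sub>3) \<subseteq> P"
    using \<Delta>_pieces[OF g] \<Delta>_pieces[OF h] split seq_inv_pieces[OF P(1)] by auto
  note car = subset_trans[OF P(1) P_carrier] subset_trans[OF P(2) P_carrier]
    subset_trans[OF P(3) P_carrier] subset_trans[OF P'(1) P_carrier]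
    subset_trans[OF P'(2) P_carrier] subset_trans[OF P'(3) P_carrier]
    subset_trans[OF P'(4) P_carrier]
  \<comment> \<open>The final segment is reversed and read from its far end \<open>z\<close>, so
    that every corner segment is integrated outward from its corner and the two copies match
    literally.\<close>
  have key: "path f x (d @ r @ seq_inv G e) = path f x d + path f (x \<otimes> group_prod G d) r - path f z e"
    if "x \<in> carrier G" "z \<in> carrier G" "set d \<subseteq> carrier G" "set r \<subseteq> carrier G" "set e \<subseteq> P"
      "x \<otimes> group_prod G (d @ r @ seq_inv G e) = z" for x z d r e
  proof -
    have e: "set e \<subseteq> carrier G" using that P_carrier by auto
    have "x \<otimes> group_prod G d \<otimes> group_prod G r = z \<otimes> group_prod G e"
      using that e by (auto simp: group_prod_append seq_inv_closed group_prod_seq_inv m_assoc)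
    then show ?thesis
      using that e path_seq_inv[of z e f] by (simp add: path_append group_prod_append m_assoc)
  qed
  let ?D = "group_prod G d\<^sub>1"
  have "integral f a b = path f a d\<^sub>1 + path f (a \<otimes> ?D) r\<^sub>1 - path f b d\<^sub>2"
    unfolding integral_def gh(1)[symmetric] split
    by (rule key) (use assms car P prod_\<Delta>[OF g] b split in auto)
  moreover have "integral f b c = path f b d\<^sub>2 + path f (b \<otimes> group_prod G d\<^sub>2) r\<^sub>2 - path f c d\<^sub>3"
    unfolding integral_def gh(2)[symmetric] split
    by (rule key) (use assms car P prod_\<Delta>[OF h] c split in auto)
  moreover have "integral f a c = path f a d\<^sub>1 + path f (a \<otimes> ?D) (seq_inv G r\<^sub>3) - path f c d\<^sub>3"
    unfolding integral_def k split
  proof (rule key)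
    show "a \<otimes> group_prod G (d\<^sub>1 @ seq_inv G r\<^sub>3 @ seq_inv G d\<^sub>3) = c"
      unfolding split(3)[symmetric] using prod_\<Delta>[of "g \<otimes> h"] g h b c assms
      by (simp add: m_assoc[symmetric])
  qed (use assms car P in auto)
  ultimately have eq: "integral f a b + integral f b c - integral f a c
      = path f (a \<otimes> ?D) r\<^sub>1 + path f (b \<otimes> group_prod G d\<^sub>2) r\<^sub>2 - path f (a \<otimes> ?D) (seq_inv G r\<^sub>3)"
    by simp
  have bd: "\<bar>path f x r\<bar> \<le> R * (B * C)"
    if "x \<in> carrier G" "set r \<subseteq> P" "length r \<le> R" for x r
  proof -
    \<comment> \<open>The bound at the point \<open>a\<close> shows that \<open>C\<close> is
      nonnegative.\<close>
    have "0 \<le> B * C" using B_nonneg C[of a] assms(1) by (intro mult_nonneg_nonneg) auto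
    then have "length r * (B * C) \<le> R * (B * C)" using that(3) by (intro mult_right_mono) auto
    then show ?thesis using path_bound[OF that(1,2), of f C] C by simp
  qed
  have "\<bar>path f (a \<otimes> ?D) r\<^sub>1\<bar> \<le> R * (B * C)" by (rule bd) (use assms car P' R in auto)
  moreover have "\<bar>path f (b \<otimes> group_prod G d\<^sub>2) r\<^sub>2\<bar> \<le> R * (B * C)"
    by (rule bd) (use assms car P' R in auto)
  moreover have "\<bar>path f (a \<otimes> ?D) (seq_inv G r\<^sub>3)\<bar> \<le> R * (B * C)"
    by (rule bd) (use assms car P' R in auto)
  ultimately show ?thesis unfolding eq by linarith
qed

end

section \<open>The homotopy operator\<close>

text \<open>This is not a cocycle, since its coboundary is the constant 1. Its truncated alternating
  sums do vanish, however, which is why \<open>coboundary_homotopy\<close> is phrased with such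
  sums.\<close>

definition one_cochain :: "('a, 'b) monoid_scheme \<Rightarrow> 'a list \<Rightarrow> real" where
  "one_cochain G xs = (if xs \<in> tuples G 1 then 1 else 0)"

context weighted_decomposition
begin

lemma one_cochain_bounded: "one_cochain G \<in> bounded_cochains G 1"
  unfolding bounded_cochains_def one_cochain_def using map_tuples by auto

text \<open>
  The degrees of \<open>f\<close> and \<open>g\<close> are \<open>Suc p\<close> and \<open>Suc q\<close>; this is the \<open>K f g\<close> above.
\<close>

definition homotopy :: "nat \<Rightarrow> nat \<Rightarrow> ('a list \<Rightarrow> real) \<Rightarrow> ('a list \<Rightarrow> real) \<Rightarrow> 'a list \<Rightarrow> real" where
  "homotopy p q f g xs = (if xs \<in> tuples G (Suc (p + q))
     then integral (\<lambda>y. f (take (Suc p) xs @ [y]) * g (y # drop (Suc p) xs)) (xs ! p) (xs ! Suc p)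
     else 0)"

lemma homotopy_append:
  assumes "length u = p" "u @ a # b # v \<in> tuples G (Suc (p + q))"
  shows "homotopy p q f g (u @ a # b # v)
    = integral (\<lambda>y. f (u @ [a, y]) * g (y # b # v)) a b"
  using assms by (simp add: homotopy_def nth_append)

text \<open>\<open>integral_translate\<close> moves the translation into the integrand, where the
  invariance of \<open>f\<close> and \<open>g\<close> absorbs it.\<close>

lemma homotopy_invariant:
  assumes f: "f \<in> invariant_cochains G (Suc p)" and g: "g \<in> invariant_cochains G (Suc q)"
  shows "homotopy p q f g \<in> invariant_cochains G (Suc (p + q))"
proof -
  have "homotopy p q f g (map (\<lambda>x. h \<otimes> x) xs) = homotopy p q f g xs"
    if h: "h \<in> carrier G" and xs: "xs \<in> tuples G (Suc (p + q))" for h xs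
  proof -
    let ?h = "\<lambda>x. h \<otimes> x"
    have len: "length xs = Suc (Suc (p + q))" using xs by (simp add: tuples_def)
    then have car: "xs ! p \<in> carrier G" "xs ! Suc p \<in> carrier G"
      using xs by (auto simp: tuples_def subset_iff)
    have "homotopy p q f g (map ?h xs) = integral (\<lambda>y. f (map ?h (take (Suc p) xs) @ [h \<otimes> y])
        * g ((h \<otimes> y) # map ?h (drop (Suc p) xs))) (xs ! p) (xs ! Suc p)"
      using map_tuples[OF h xs] len
      by (simp add: homotopy_def integral_translate[OF h car] take_map drop_map)
    also have "\<dots> = integral (\<lambda>y. f (take (Suc p) xs @ [y]) * g (y # drop (Suc p) xs)) (xs ! p) (xs ! Suc p)"
    proof (rule integral_cong[OF car])
      fix y assume y: "y \<in> carrier G"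
      have "take (Suc p) xs @ [y] \<in> tuples G (Suc p)" "y # drop (Suc p) xs \<in> tuples G (Suc q)"
        using xs y by (auto simp: tuples_def dest: in_set_takeD in_set_dropD)
      then show "f (map ?h (take (Suc p) xs) @ [h \<otimes> y]) * g ((h \<otimes> y) # map ?h (drop (Suc p) xs))
          = f (take (Suc p) xs @ [y]) * g (y # drop (Suc p) xs)"
        using invariant_cochainsD[OF f h, of "take (Suc p) xs @ [y]"]
          invariant_cochainsD[OF g h, of "y # drop (Suc p) xs"] by simp
    qed
    finally show ?thesis using xs by (simp add: homotopy_def)
  qed
  then show ?thesis by (simp add: invariant_cochains_def) (simp add: homotopy_def)
qed

text \<open>The entries \<open>a\<close>, \<open>b\<close>, \<open>c\<close> become the corners of a
  triangle: deleting an entry up to \<open>a\<close>, the entry \<open>b\<close>, or one from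
  \<open>c\<close> on leaves a homotopy that integrates from \<open>b\<close> to \<open>c\<close>,
  from \<open>a\<close> to \<open>c\<close>, or from \<open>a\<close> to \<open>b\<close>.\<close>

lemma tuples_split:
  assumes "xs \<in> tuples G (Suc (Suc (p + q)))"
  obtains u a b c v where "xs = u @ a # b # c # v" "length u = p" "length v = q"
    "set u \<subseteq> carrier G" "a \<in> carrier G" "b \<in> carrier G" "c \<in> carrier G" "set v \<subseteq> carrier G"
proof -
  have len: "length xs = Suc (Suc (Suc (p + q)))" and car: "set xs \<subseteq> carrier G"
    using assms by (auto simp: tuples_def)
  obtain a b c v where d: "drop p xs = a # b # c # v" "length v = q"
  proof -
    have "length (drop p xs) = Suc (Suc (Suc q))" using len by simp
    then show thesis using that by (metis length_Suc_conv)
  qed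
  have xs: "xs = take p xs @ a # b # c # v" by (metis d(1) append_take_drop_id)
  then have "set (take p xs @ a # b # c # v) \<subseteq> carrier G" using car by simp
  then show thesis using that[OF xs] d(2) len by simp
qed

text \<open>
  The relevant \<open>f'\<close> is \<open>(-1)\<^sup>n f\<close> for a cocycle \<open>f\<close> of degree \<open>n\<close> and \<open>0\<close> for \<open>f = 1\<close>; likewise \<open>g'\<close> is
  \<open>g\<close> or \<open>0\<close>.
\<close>

lemma coboundary_homotopy:
  assumes f: "f \<in> bounded_cochains G (Suc p)" and g: "g \<in> bounded_cochains G (Suc q)"
    and f': "f' \<in> invariant_cochains G (Suc p)" and g': "g' \<in> invariant_cochains G (Suc q)"
    and ff': "\<And>xs y. xs \<in> tuples G (Suc p) \<Longrightarrow> y \<in> carrier G \<Longrightarrow>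
      (\<Sum>i\<le>Suc p. (- 1) ^ i * f (face i xs @ [y])) = f' xs"
    and gg': "\<And>xs y. xs \<in> tuples G (Suc q) \<Longrightarrow> y \<in> carrier G \<Longrightarrow>
      (\<Sum>i\<le>Suc q. (- 1) ^ i * g (y # face i xs)) = g' xs"
  shows "(\<lambda>xs. coboundary G (Suc (p + q)) (homotopy p q f g) xs
      - (cup_cochain G (Suc p) (Suc q) f' (homotopy 0 q (one_cochain G) g) xs
        + (- 1) ^ Suc p * cup_cochain G (Suc p) (Suc q) (homotopy p 0 f (one_cochain G)) g' xs))
    \<in> bounded_cochains G (Suc p + Suc q)" (is "?E \<in> _")
proof -
  obtain C D where C: "\<And>xs. xs \<in> tuples G (Suc p) \<Longrightarrow> \<bar>f xs\<bar> \<le> C"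
    and D: "\<And>xs. xs \<in> tuples G (Suc q) \<Longrightarrow> \<bar>g xs\<bar> \<le> D"
    using f g unfolding bounded_cochains_iff by blast
  have fi: "f \<in> invariant_cochains G (Suc p)" and gi: "g \<in> invariant_cochains G (Suc q)"
    and one: "one_cochain G \<in> invariant_cochains G (Suc 0)"
    using f g one_cochain_bounded by (simp_all add: bounded_cochains_iff)
  have 1: "coboundary G (Suc (p + q)) (homotopy p q f g) \<in> invariant_cochains G (Suc p + Suc q)"
    using coboundary_invariant[OF homotopy_invariant[OF fi gi]] by simp
  have 2: "cup_cochain G (Suc p) (Suc q) f' (homotopy 0 q (one_cochain G) g) \<in> invariant_cochains G (Suc p + Suc q)"
    using cup_invariant[OF f' homotopy_invariant[OF one gi]] by simp
  have 3: "cup_cochain G (Suc p) (Suc q) (homotopy p 0 f (one_cochain G)) g' \<in> invariant_cochains G (Suc p + Suc q)"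
    using cup_invariant[OF homotopy_invariant[OF fi one] g'] by simp
  have inv: "?E \<in> invariant_cochains G (Suc p + Suc q)"
    using invariant_cochains_lincomb[OF 1
        invariant_cochains_lincomb[OF 2 3, of 1 "(- 1) ^ Suc p"], of 1 "- 1"]
    by (simp add: algebra_simps)
  \<comment> \<open>This is the constant of \<open>integral_triangle\<close> for an integrand
    bounded by \<open>C * D\<close>.\<close>
  have "\<bar>?E xs\<bar> \<le> 3 * (R * (B * (C * D)))" if xs: "xs \<in> tuples G (Suc p + Suc q)" for xs
  proof -
    from xs have xs': "xs \<in> tuples G (Suc (Suc (p + q)))" by simp
    then obtain u a b c v where eq: "xs = u @ a # b # c # v" and len: "length u = p" "length v = q"
      and car: "set u \<subseteq> carrier G" "a \<in> carrier G" "b \<in> carrier G" "c \<in> carrier G"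
        "set v \<subseteq> carrier G"
      by (rule tuples_split)
    let ?K = "homotopy p q f g" and ?s = "(- 1 :: real) ^ Suc p"
    \<comment> \<open>The integrand common to all three sides; the remainder will be, up to sign,
      its integral over the triangle.\<close>
    define h where "h = (\<lambda>y. f (u @ [a, y]) * g (y # c # v))"
    have tf: "face i xs \<in> tuples G (Suc (p + q))" if "i \<le> Suc (Suc (p + q))" for i
      using face_tuples[OF xs' that] .
    have ab: "u @ [a, b] \<in> tuples G (Suc p)" and bcv: "b # c # v \<in> tuples G (Suc q)"
      using len car by (auto simp: tuples_def)
    have low: "?K (face i xs) = integral (\<lambda>y. f (face i (u @ [a, b]) @ [y]) * g (y # c # v)) b c"
      if "i \<le> p" for i
    proof -
      have i: "face i (u @ [a, b]) = face i (u @ [a]) @ [b]"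
        using face_append1[of i "u @ [a]" "[b]"] that len by simp
      have e: "face i xs = face i (u @ [a]) @ b # c # v"
        using face_append1[of i "u @ [a]" "b # c # v"] that len eq by simp
      have "length (face i (u @ [a])) = p" using that len by (simp add: face_def)
      then show ?thesis
        using homotopy_append[of "face i (u @ [a])" p b c v q f g] tf[of i] that e i by simp
    qed
    have mid: "?K (face (Suc p) xs) = integral h a c"
    proof -
      have e: "face (Suc p) xs = u @ a # c # v"
        using face_append2[of u 1 "a # b # c # v"] len eq by simp
      then show ?thesis
        using homotopy_append[OF len(1), of a c v q f g] tf[of "Suc p"] by (simp add: h_def)
    qed
    have high: "?K (face (Suc (Suc p) + i) xs)
        = integral (\<lambda>y. f (u @ [a, y]) * g (y # face (Suc i) (b # c # v))) a b"
      if "i \<le> q" for i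
    proof -
      have e: "face (Suc (Suc p) + i) xs = u @ a # b # face i (c # v)"
        using face_append2[of u "Suc (Suc i)" "a # b # c # v"] len eq by simp
      then show ?thesis
        using homotopy_append[OF len(1), of a b "face i (c # v)" q f g] tf[of "Suc (Suc p) + i"] that
        by simp
    qed
    let ?c = "\<lambda>i. (- 1) ^ i * ?K (face i xs)"
    have "coboundary G (Suc (p + q)) ?K xs = sum ?c {..Suc (Suc p) + q}"
      by (simp only: coboundary_face[OF xs'] add_Suc)
    also have "{..Suc (Suc p) + q} = {..p} \<union> ({Suc p} \<union> {Suc (Suc p)..Suc (Suc p) + q})" by auto
    also have "sum ?c \<dots> = sum ?c {..p} + sum ?c ({Suc p} \<union> {Suc (Suc p)..Suc (Suc p) + q})"
      by (rule sum.union_disjoint) auto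
    also have "sum ?c ({Suc p} \<union> {Suc (Suc p)..Suc (Suc p) + q})
        = ?c (Suc p) + sum ?c {Suc (Suc p)..Suc (Suc p) + q}"
      by (subst sum.union_disjoint) auto
    also have "sum ?c {Suc (Suc p)..Suc (Suc p) + q} = (\<Sum>i\<le>q. ?c (Suc (Suc p) + i))"
      by (rule sum_atLeastAtMost_shift)
    also have "\<dots> = (\<Sum>i\<le>q. integral (\<lambda>y. (- 1) ^ (Suc (Suc p) + i)
        * (f (u @ [a, y]) * g (y # face (Suc i) (b # c # v)))) a b)"
      unfolding integral_cmult by (intro sum.cong) (simp_all only: high atMost_iff)
    also have "\<dots> = integral (\<lambda>y. (\<Sum>i\<le>q. (- 1) ^ (Suc (Suc p) + i)
        * (f (u @ [a, y]) * g (y # face (Suc i) (b # c # v))))) a b"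
      by (rule integral_sum[symmetric])
    \<comment> \<open>The face of \<open>b # c # v\<close> that deletes \<open>b\<close> is missing
      from the sum. Completing the sum to \<open>g'\<close> costs one copy of
      \<open>h\<close>.\<close>
    also have "\<dots> = integral (\<lambda>y. ?s * (g' (b # c # v) * f (u @ [a, y]) + (- 1) * h y)) a b"
    proof (rule integral_cong[OF car(2,3)])
      fix y assume y: "y \<in> carrier G"
      have "g' (b # c # v) = g (y # c # v) + (\<Sum>i\<le>q. (- 1) ^ Suc i * g (y # face (Suc i) (b # c # v)))"
        unfolding gg'[OF bcv y, symmetric] sum.atMost_Suc_shift by simp
      moreover have "(\<Sum>i\<le>q. (- 1) ^ (Suc (Suc p) + i) * (f (u @ [a, y]) * g (y # face (Suc i) (b # c # v))))
          = ?s * f (u @ [a, y]) * (\<Sum>i\<le>q. (- 1) ^ Suc i * g (y # face (Suc i) (b # c # v)))"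
        unfolding sum_distrib_left by (intro sum.cong) (simp_all add: power_add)
      ultimately show "(\<Sum>i\<le>q. (- 1) ^ (Suc (Suc p) + i) * (f (u @ [a, y]) * g (y # face (Suc i) (b # c # v))))
          = ?s * (g' (b # c # v) * f (u @ [a, y]) + (- 1) * h y)"
        by (simp add: h_def algebra_simps)
    qed
    also have "\<dots> = ?s * (g' (b # c # v) * integral (\<lambda>y. f (u @ [a, y])) a b - integral h a b)"
      unfolding integral_cmult integral_add by simp
    also have "sum ?c {..p} = (\<Sum>i\<le>p. integral (\<lambda>y. (- 1) ^ i
        * (f (face i (u @ [a, b]) @ [y]) * g (y # c # v))) b c)"
      unfolding integral_cmult by (intro sum.cong) (simp_all only: low atMost_iff)
    also have "\<dots> = integral (\<lambda>y. (\<Sum>i\<le>p. (- 1) ^ i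
        * (f (face i (u @ [a, b]) @ [y]) * g (y # c # v)))) b c"
      by (rule integral_sum[symmetric])
    \<comment> \<open>Likewise, the missing face of \<open>u @ [a, b]\<close> is the one deleting
      \<open>b\<close>, and completing the sum to \<open>f'\<close> again costs a copy of
      \<open>h\<close>.\<close>
    also have "\<dots> = integral (\<lambda>y. f' (u @ [a, b]) * g (y # c # v) + (- ?s) * h y) b c"
    proof (rule integral_cong[OF car(3,4)])
      fix y assume y: "y \<in> carrier G"
      have "face (Suc p) (u @ [a, b]) = u @ [a]"
        using face_append2[of u 1 "[a, b]"] len by simp
      then have e1: "f' (u @ [a, b]) = (\<Sum>i\<le>p. (- 1) ^ i * f (face i (u @ [a, b]) @ [y])) + ?s * f (u @ [a, y])"
        unfolding ff'[OF ab y, symmetric] sum.atMost_Suc by simp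
      have e2: "(\<Sum>i\<le>p. (- 1) ^ i * (f (face i (u @ [a, b]) @ [y]) * g (y # c # v)))
          = (\<Sum>i\<le>p. (- 1) ^ i * f (face i (u @ [a, b]) @ [y])) * g (y # c # v)"
        unfolding sum_distrib_right by (intro sum.cong) simp_all
      show "(\<Sum>i\<le>p. (- 1) ^ i * (f (face i (u @ [a, b]) @ [y]) * g (y # c # v)))
          = f' (u @ [a, b]) * g (y # c # v) + (- ?s) * h y"
        unfolding e2 e1 by (simp add: h_def algebra_simps)
    qed
    also have "\<dots> = f' (u @ [a, b]) * integral (\<lambda>y. g (y # c # v)) b c - ?s * integral h b c"
      unfolding integral_cmult integral_add by simp
    finally have co: "coboundary G (Suc (p + q)) ?K xs
        = f' (u @ [a, b]) * integral (\<lambda>y. g (y # c # v)) b c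
          + ?s * (g' (b # c # v) * integral (\<lambda>y. f (u @ [a, y])) a b)
          - ?s * (integral h a b + integral h b c - integral h a c)"
      by (simp add: mid algebra_simps)
    \<comment> \<open>The constant cochain equals 1 along the path, so the integral of the single
      remaining factor is itself a homotopy.\<close>
    have "homotopy 0 q (one_cochain G) g (b # c # v) = integral (\<lambda>y. g (y # c # v)) b c"
    proof -
      have "homotopy 0 q (one_cochain G) g (b # c # v) = integral (\<lambda>y. one_cochain G [b, y] * g (y # c # v)) b c"
        using homotopy_append[of "[]" 0 b c v q] bcv by simp
      also have "\<dots> = integral (\<lambda>y. g (y # c # v)) b c"
        by (rule integral_cong) (use car in \<open>auto simp: one_cochain_def tuples_def\<close>)
      finally show ?thesis .
    qed
    moreover have "homotopy p 0 f (one_cochain G) (u @ [a, b]) = integral (\<lambda>y. f (u @ [a, y])) a b"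
    proof -
      have "homotopy p 0 f (one_cochain G) (u @ [a, b]) = integral (\<lambda>y. f (u @ [a, y]) * one_cochain G [y, b]) a b"
        using homotopy_append[OF len(1), of a b "[]" 0] ab by simp
      also have "\<dots> = integral (\<lambda>y. f (u @ [a, y])) a b"
        by (rule integral_cong) (use car in \<open>auto simp: one_cochain_def tuples_def\<close>)
      finally show ?thesis .
    qed
    moreover have "take (Suc (Suc p)) xs = u @ [a, b]" "drop (Suc p) xs = b # c # v"
      using eq len by simp_all
    ultimately have "?E xs = - ?s * (integral h a b + integral h b c - integral h a c)"
      using xs unfolding co by (simp add: cup_cochain_def)
    then have "\<bar>?E xs\<bar> = \<bar>integral h a b + integral h b c - integral h a c\<bar>"
      by (simp add: abs_mult power_abs)
    also have "\<dots> \<le> 3 * (R * (B * (C * D)))"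
    proof (rule integral_triangle[OF car(2-4)])
      fix y assume "y \<in> carrier G"
      then have "u @ [a, y] \<in> tuples G (Suc p)" "y # c # v \<in> tuples G (Suc q)"
        using len car by (auto simp: tuples_def)
      then show "\<bar>h y\<bar> \<le> C * D"
        using C D by (fastforce simp: h_def abs_mult intro!: mult_mono)
    qed
    finally show ?thesis .
  qed
  then show ?thesis using inv by (auto simp: bounded_cochains_iff)
qed

text \<open>On \<open>xs @ [y]\<close> the last face deletes \<open>y\<close>. Moving its term
  across turns the sign (-1)^(n+1) into (-1)^n.\<close>

lemma cocycle_sum_left:
  assumes f: "f \<in> bounded_cocycles G n" and xs: "xs \<in> tuples G n" and y: "y \<in> carrier G"
  shows "(\<Sum>i\<le>n. (- 1) ^ i * f (face i xs @ [y])) = (- 1) ^ n * f xs"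
proof -
  have len: "length xs = Suc n" using xs by (simp add: tuples_def)
  have t: "xs @ [y] \<in> tuples G (Suc n)" using xs y by (simp add: tuples_def)
  have "face i (xs @ [y]) = face i xs @ [y]" if "i \<le> n" for i
    using face_append1[of i xs "[y]"] len that by simp
  then have "(\<Sum>i\<le>n. (- 1) ^ i * f (face i (xs @ [y]))) = (\<Sum>i\<le>n. (- 1) ^ i * f (face i xs @ [y]))"
    by (intro sum.cong) auto
  moreover have "face (Suc n) (xs @ [y]) = xs" using face_last[of xs y] len by simp
  ultimately show ?thesis
    using fun_cong[OF bounded_cocycleD(2)[OF f], of "xs @ [y]"]
    unfolding coboundary_face[OF t] sum.atMost_Suc by simp
qed

text \<open>Here \<open>y\<close> is deleted by face 0, with sign +, while the other faces are
  shifted by one; so no sign survives.\<close>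

lemma cocycle_sum_right:
  assumes f: "f \<in> bounded_cocycles G n" and xs: "xs \<in> tuples G n" and y: "y \<in> carrier G"
  shows "(\<Sum>i\<le>n. (- 1) ^ i * f (y # face i xs)) = f xs"
proof -
  have t: "y # xs \<in> tuples G (Suc n)" using xs y by (simp add: tuples_def)
  show ?thesis
    using fun_cong[OF bounded_cocycleD(2)[OF f], of "y # xs"]
    unfolding coboundary_face[OF t] sum.atMost_Suc_shift by (simp add: sum_negf)
qed

lemma one_cochain_sum:
  assumes "xs \<in> tuples G 1" "y \<in> carrier G"
  shows "(\<Sum>i\<le>1. (- 1) ^ i * one_cochain G (face i xs @ [y])) = 0"
    and "(\<Sum>i\<le>1. (- 1) ^ i * one_cochain G (y # face i xs)) = 0"
proof -
  obtain a b where "xs = [a, b]" "a \<in> carrier G" "b \<in> carrier G"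
    using assms(1) by (auto simp: tuples_def length_Suc_conv)
  then show "(\<Sum>i\<le>1. (- 1) ^ i * one_cochain G (face i xs @ [y])) = 0"
    "(\<Sum>i\<le>1. (- 1) ^ i * one_cochain G (y # face i xs)) = 0"
    using assms(2) by (simp_all add: one_cochain_def tuples_def)
qed

section \<open>Cup and Massey products with the class of a decomposable quasimorphism\<close>

lemma hat_decomposable:
  "hat G (decomposable l \<Delta>) = homotopy 0 0 (one_cochain G) (one_cochain G)"
proof
  fix xs
  show "hat G (decomposable l \<Delta>) xs = homotopy 0 0 (one_cochain G) (one_cochain G) xs"
  proof (cases "xs \<in> tuples G 1")
    case True
    then obtain a b where ab: "xs = [a, b]" "a \<in> carrier G" "b \<in> carrier G"
      by (auto simp: tuples_def length_Suc_conv)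
    have "homotopy 0 0 (one_cochain G) (one_cochain G) xs
        = integral (\<lambda>y. one_cochain G [a, y] * one_cochain G [y, b]) a b"
      using True by (simp add: homotopy_def ab)
    also have "\<dots> = integral (\<lambda>_. 1) a b"
      by (rule integral_cong) (use ab in \<open>auto simp: one_cochain_def tuples_def\<close>)
    finally show ?thesis using True by (simp add: hat_def integral_one ab)
  qed (simp add: hat_def homotopy_def)
qed

abbreviation phi :: "'a list \<Rightarrow> real" where
  "phi \<equiv> hat G (decomposable l \<Delta>)"

text \<open>The case \<open>f = g = 1\<close> with \<open>f' = g' = 0\<close>: both cup terms of the
  homotopy formula vanish and the coboundary is the bounded remainder.\<close>

lemma coboundary_hat_bounded: "coboundary G 1 phi \<in> bounded_cochains G 2"
  using coboundary_homotopy[OF one_cochain_bounded[unfolded One_nat_def] one_cochain_bounded[unfolded One_nat_def]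
      zero_invariant_cochain zero_invariant_cochain
      one_cochain_sum(1)[unfolded One_nat_def] one_cochain_sum(2)[unfolded One_nat_def]]
  by (simp add: hat_decomposable numeral_2_eq_2)

lemma quasimorphism_decomposable: "quasimorphism G (decomposable l \<Delta>)"
proof -
  obtain C where C: "\<And>xs. xs \<in> tuples G 2 \<Longrightarrow> \<bar>coboundary G 1 phi xs\<bar> \<le> C"
    using coboundary_hat_bounded by (auto simp: bounded_cochains_iff)
  let ?\<phi> = "decomposable l \<Delta>"
  have "\<bar>?\<phi> g + ?\<phi> h - ?\<phi> (g \<otimes> h)\<bar> \<le> C" if gh: "g \<in> carrier G" "h \<in> carrier G" for g h
  proof -
    \<comment> \<open>On this triple the coboundary of \<open>phi\<close> is exactly the defect of
      the quasimorphism at \<open>g\<close>, \<open>h\<close>.\<close>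
    let ?xs = "[\<one>, g, g \<otimes> h]"
    have t: "?xs \<in> tuples G 2" using gh by (simp add: tuples_def)
    have "inv g \<otimes> (g \<otimes> h) = h" using gh by (simp add: m_assoc[symmetric])
    then have "coboundary G 1 phi ?xs = ?\<phi> h - ?\<phi> (g \<otimes> h) + ?\<phi> g"
      using t gh coboundary_face[of ?xs G 1 phi]
      by (simp add: numeral_2_eq_2 hat_def tuples_def)
    then show ?thesis using C[OF t] by (simp add: algebra_simps)
  qed
  then show ?thesis unfolding quasimorphism_def by (intro bdd_aboveI[of _ C]) auto
qed

text \<open>
  Coefficients such as \<open>1 *\<close> are kept so that the linearity lemmas apply by unification.
\<close>

definition left_primitive :: "nat \<Rightarrow> ('a list \<Rightarrow> real) \<Rightarrow> 'a list \<Rightarrow> real" where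
  "left_primitive p \<omega> = (\<lambda>xs. (- 1) ^ Suc p * cup_cochain G (Suc p) 1 \<omega> phi xs
     + (- 1) * coboundary G (Suc p) (homotopy p 0 \<omega> (one_cochain G)) xs)"

definition right_primitive :: "nat \<Rightarrow> ('a list \<Rightarrow> real) \<Rightarrow> 'a list \<Rightarrow> real" where
  "right_primitive q \<omega> = (\<lambda>xs. 1 * cup_cochain G 1 (Suc q) phi \<omega> xs
     + 1 * coboundary G (Suc q) (homotopy 0 q (one_cochain G) \<omega>) xs)"

lemma cocycle_cmult_invariant:
  "\<omega> \<in> bounded_cocycles G n \<Longrightarrow> (\<lambda>xs. c * \<omega> xs) \<in> invariant_cochains G n"
  using invariant_cochains_lincomb[of \<omega> G n \<omega> c 0] bounded_cocycleD(1)
  by (auto simp: bounded_cochains_iff)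

text \<open>Boundedness is the homotopy formula for \<open>g = 1\<close>. The correction term is a
  coboundary, so it does not affect \<delta>, and the sign of the Leibniz rule squares away.\<close>

lemma left_primitive:
  assumes \<omega>: "\<omega> \<in> bounded_cocycles G (Suc p)"
  shows "left_primitive p \<omega> \<in> bounded_cochains G (Suc (Suc p))"
    and "coboundary G (Suc (Suc p)) (left_primitive p \<omega>)
      = cup_cochain G (Suc p) 2 \<omega> (coboundary G 1 phi)"
proof -
  note E = coboundary_homotopy[OF bounded_cocycleD(1)[OF \<omega>] one_cochain_bounded[unfolded One_nat_def]
      cocycle_cmult_invariant[OF \<omega>] zero_invariant_cochain
      cocycle_sum_left[OF \<omega>] one_cochain_sum(2)[unfolded One_nat_def], folded hat_decomposable]
  show "left_primitive p \<omega> \<in> bounded_cochains G (Suc (Suc p))"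
    \<comment> \<open>The coefficients -1 and 0 merely negate the bounded remainder.\<close>
    using bounded_cochains_lincomb[OF E E, of "- 1" 0, unfolded cup_cochain_cmult_left]
    by (simp add: left_primitive_def algebra_simps)
  show "coboundary G (Suc (Suc p)) (left_primitive p \<omega>)
      = cup_cochain G (Suc p) 2 \<omega> (coboundary G 1 phi)"
    unfolding left_primitive_def coboundary_lincomb coboundary_coboundary
    using coboundary_cup_cocycle_left[OF bounded_cocycleD(2)[OF \<omega>], of 1 phi]
    by (simp add: numeral_2_eq_2 power_mult_distrib[symmetric])
qed

text \<open>With \<open>f = 1\<close> of degree 1 the cup term in the homotopy formula has sign -1,
  whence the plus sign in \<open>right_primitive\<close>.\<close>

lemma right_primitive:
  assumes \<omega>: "\<omega> \<in> bounded_cocycles G (Suc q)"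
  shows "right_primitive q \<omega> \<in> bounded_cochains G (Suc (Suc q))"
    and "coboundary G (Suc (Suc q)) (right_primitive q \<omega>)
      = cup_cochain G 2 (Suc q) (coboundary G 1 phi) \<omega>"
proof -
  have \<omega>': "\<omega> \<in> invariant_cochains G (Suc q)"
    using bounded_cocycleD(1)[OF \<omega>] by (simp add: bounded_cochains_iff)
  note E = coboundary_homotopy[OF one_cochain_bounded[unfolded One_nat_def] bounded_cocycleD(1)[OF \<omega>]
      zero_invariant_cochain \<omega>'
      one_cochain_sum(1)[unfolded One_nat_def] cocycle_sum_right[OF \<omega>], folded hat_decomposable]
  show "right_primitive q \<omega> \<in> bounded_cochains G (Suc (Suc q))"
    using E by (simp add: right_primitive_def add.commute)
  show "coboundary G (Suc (Suc q)) (right_primitive q \<omega>)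
      = cup_cochain G 2 (Suc q) (coboundary G 1 phi) \<omega>"
    unfolding right_primitive_def coboundary_lincomb coboundary_coboundary
    using coboundary_cup_cocycle_right[OF bounded_cocycleD(2)[OF \<omega>], of 1 phi]
    by (simp add: numeral_2_eq_2)
qed

lemma massey_representative:
  assumes \<omega>\<^sub>1: "\<omega>\<^sub>1 \<in> bounded_cocycles G (Suc p)" and \<omega>\<^sub>2: "\<omega>\<^sub>2 \<in> bounded_cocycles G (Suc q)"
  obtains \<theta> where "\<theta> \<in> bounded_cochains G (Suc p + Suc q)"
    "coboundary G (Suc p + Suc q) \<theta> = (\<lambda>xs.
       (- 1) ^ Suc p * cup_cochain G (Suc p) (Suc (Suc q)) \<omega>\<^sub>1 (right_primitive q \<omega>\<^sub>2) xs
       - cup_cochain G (Suc (Suc p)) (Suc q) (left_primitive p \<omega>\<^sub>1) \<omega>\<^sub>2 xs)"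
proof -
  let ?e = "(- 1 :: real) ^ Suc p"
  have \<omega>\<^sub>2': "\<omega>\<^sub>2 \<in> invariant_cochains G (Suc q)"
    using bounded_cocycleD(1)[OF \<omega>\<^sub>2] by (simp add: bounded_cochains_iff)
  define \<kappa> where "\<kappa> = homotopy p q \<omega>\<^sub>1 \<omega>\<^sub>2"
  define \<eta>\<^sub>1 where "\<eta>\<^sub>1 = homotopy p 0 \<omega>\<^sub>1 (one_cochain G)"
  define \<eta>\<^sub>2 where "\<eta>\<^sub>2 = homotopy 0 q (one_cochain G) \<omega>\<^sub>2"
  let ?A = "cup_cochain G (Suc p) (Suc q) \<omega>\<^sub>1 \<eta>\<^sub>2" and ?B = "cup_cochain G (Suc p) (Suc q) \<eta>\<^sub>1 \<omega>\<^sub>2"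
  \<comment> \<open>The bounded remainder of the homotopy formula for the two cocycles.\<close>
  define b where "b = (\<lambda>xs. 1 * coboundary G (Suc (p + q)) \<kappa> xs + (- ?e) * (1 * ?A xs + 1 * ?B xs))"
  have b: "b \<in> bounded_cochains G (Suc p + Suc q)"
    using coboundary_homotopy[OF bounded_cocycleD(1)[OF \<omega>\<^sub>1] bounded_cocycleD(1)[OF \<omega>\<^sub>2]
        cocycle_cmult_invariant[OF \<omega>\<^sub>1] \<omega>\<^sub>2' cocycle_sum_left[OF \<omega>\<^sub>1] cocycle_sum_right[OF \<omega>\<^sub>2],
        unfolded cup_cochain_cmult_left]
    by (simp add: b_def \<kappa>_def \<eta>\<^sub>1_def \<eta>\<^sub>2_def algebra_simps)
  \<comment> \<open>As \<open>?e * ?e = 1\<close>, this is \<open>?A + ?B\<close> minus a multiple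
    of the coboundary of \<open>\<kappa>\<close>: bounded, yet with the same coboundary as
    \<open>?A + ?B\<close>. The summand with coefficient 0 fits the linearity lemmas.\<close>
  define \<theta> where "\<theta> = (\<lambda>xs. (- ?e) * b xs + 0 * b xs)"
  have "coboundary G (Suc p + Suc q) (coboundary G (Suc (p + q)) \<kappa>) = (\<lambda>_. 0)"
    using coboundary_coboundary[of G "Suc (p + q)" \<kappa>] by simp
  then have "coboundary G (Suc p + Suc q) \<theta> = (\<lambda>xs. ?e * ?e * (coboundary G (Suc p + Suc q) ?A xs
      + coboundary G (Suc p + Suc q) ?B xs))"
    unfolding \<theta>_def b_def coboundary_lincomb coboundary_cmult
    by (simp add: fun_eq_iff algebra_simps)
  also have "\<dots> = (\<lambda>xs. coboundary G (Suc p + Suc q) ?A xs + coboundary G (Suc p + Suc q) ?B xs)"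
    by (simp add: power_mult_distrib[symmetric])
  also have "\<dots> = (\<lambda>xs. ?e * cup_cochain G (Suc p) (Suc (Suc q)) \<omega>\<^sub>1 (coboundary G (Suc q) \<eta>\<^sub>2) xs
      + cup_cochain G (Suc (Suc p)) (Suc q) (coboundary G (Suc p) \<eta>\<^sub>1) \<omega>\<^sub>2 xs)"
    unfolding coboundary_cup_cocycle_left[OF bounded_cocycleD(2)[OF \<omega>\<^sub>1]]
      coboundary_cup_cocycle_right[OF bounded_cocycleD(2)[OF \<omega>\<^sub>2]] by (rule refl)
  finally have \<theta>: "coboundary G (Suc p + Suc q) \<theta> = (\<lambda>xs.
      ?e * cup_cochain G (Suc p) (Suc (Suc q)) \<omega>\<^sub>1 (coboundary G (Suc q) \<eta>\<^sub>2) xs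
      + cup_cochain G (Suc (Suc p)) (Suc q) (coboundary G (Suc p) \<eta>\<^sub>1) \<omega>\<^sub>2 xs)" .
  \<comment> \<open>This makes the triple products of \<open>\<omega>\<^sub>1\<close>,
    \<open>phi\<close>, \<open>\<omega>\<^sub>2\<close> from the two primitives cancel, leaving only
    the coboundaries of \<open>\<eta>\<^sub>1\<close> and \<open>\<eta>\<^sub>2\<close>.\<close>
  have assoc: "cup_cochain G (Suc (Suc p)) (Suc q) (cup_cochain G (Suc p) 1 \<omega>\<^sub>1 phi) \<omega>\<^sub>2
      = cup_cochain G (Suc p) (Suc (Suc q)) \<omega>\<^sub>1 (cup_cochain G 1 (Suc q) phi \<omega>\<^sub>2)"
    using cup_cochain_assoc[of G "Suc p" 1 "Suc q" \<omega>\<^sub>1 phi \<omega>\<^sub>2] by simp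
  have "coboundary G (Suc p + Suc q) \<theta> = (\<lambda>xs.
      ?e * cup_cochain G (Suc p) (Suc (Suc q)) \<omega>\<^sub>1 (right_primitive q \<omega>\<^sub>2) xs
      - cup_cochain G (Suc (Suc p)) (Suc q) (left_primitive p \<omega>\<^sub>1) \<omega>\<^sub>2 xs)"
    unfolding \<theta> left_primitive_def right_primitive_def cup_cochain_lincomb_left
      cup_cochain_lincomb_right assoc \<eta>\<^sub>1_def \<eta>\<^sub>2_def
    by (simp add: fun_eq_iff algebra_simps)
  moreover have "\<theta> \<in> bounded_cochains G (Suc p + Suc q)"
    unfolding \<theta>_def by (rule bounded_cochains_lincomb[OF b b])
  ultimately show thesis by (rule that[rotated])
qed

section \<open>Passage from cochains to classes\<close>

lemma quasimorphism_classE: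
  assumes "u \<in> quasimorphism_class G (decomposable l \<Delta>)"
  obtains h where "h \<in> bounded_cochains G 1" "u = (\<lambda>xs. 1 * coboundary G 1 h xs + 1 * coboundary G 1 phi xs)"
  using assms cohomology_classE[of u 1 "coboundary G 1 phi"]
  unfolding quasimorphism_class_def by (auto simp: numeral_2_eq_2)

lemma hat_in_quasimorphism_class:
  "coboundary G 1 phi \<in> quasimorphism_class G (decomposable l \<Delta>)"
  using cohomology_class_self[of "coboundary G 1 phi" 1]
  by (simp add: quasimorphism_class_def numeral_2_eq_2)

lemma cup_product_left_trivial:
  assumes \<alpha>: "\<alpha> \<in> carrier (bounded_cohomology G (Suc p))"
  shows "cup_product G (Suc p) 2 \<alpha> (quasimorphism_class G (decomposable l \<Delta>))
    = bounded_coboundaries G (Suc p + 2)"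
proof -
  have "cohomology_class G (Suc p + 2) (cup_cochain G (Suc p) 2 \<omega> u) = bounded_coboundaries G (Suc p + 2)"
    if \<omega>: "\<omega> \<in> \<alpha>" and u: "u \<in> quasimorphism_class G (decomposable l \<Delta>)" for \<omega> u
  proof -
    have \<omega>: "\<omega> \<in> bounded_cocycles G (Suc p)" using \<omega> bounded_cohomology_classD[OF \<alpha>] by blast
    obtain h where h: "h \<in> bounded_cochains G 1"
      and u: "u = (\<lambda>xs. 1 * coboundary G 1 h xs + 1 * coboundary G 1 phi xs)"
      by (rule quasimorphism_classE[OF u])
    \<comment> \<open>The first summand accounts for changing the representative by the coboundary
      of \<open>h\<close>, the second for the coboundary of \<open>phi\<close>.\<close>
    let ?b = "\<lambda>xs. (- 1) ^ Suc p * cup_cochain G (Suc p) 1 \<omega> h xs + 1 * left_primitive p \<omega> xs"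
    have "cup_cochain G (Suc p) 1 \<omega> h \<in> bounded_cochains G (Suc (Suc p))"
      using cup_bounded[OF bounded_cocycleD(1)[OF \<omega>] h] by simp
    then have b: "?b \<in> bounded_cochains G (Suc (Suc p))"
      using left_primitive(1)[OF \<omega>] by (rule bounded_cochains_lincomb)
    have "coboundary G (Suc (Suc p)) ?b = cup_cochain G (Suc p) 2 \<omega> u"
      unfolding u coboundary_lincomb cup_cochain_lincomb_right left_primitive(2)[OF \<omega>]
      using coboundary_cup_cocycle_left[OF bounded_cocycleD(2)[OF \<omega>], of 1 h]
      by (simp add: numeral_2_eq_2 power_mult_distrib[symmetric])
    then show ?thesis using cohomology_class_coboundary[OF b] by simp
  qed
  then show ?thesis
    \<comment> \<open>Both index sets are nonempty and every member of the union is the zero class,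
      so the union is the zero class.\<close>
    using bounded_cohomology_classD(2)[OF \<alpha>] hat_in_quasimorphism_class
    unfolding cup_product_def by (auto cong: SUP_cong)
qed

lemma cup_product_right_trivial:
  assumes \<alpha>: "\<alpha> \<in> carrier (bounded_cohomology G (Suc q))"
  shows "cup_product G 2 (Suc q) (quasimorphism_class G (decomposable l \<Delta>)) \<alpha>
    = bounded_coboundaries G (2 + Suc q)"
proof -
  have "cohomology_class G (2 + Suc q) (cup_cochain G 2 (Suc q) u \<omega>) = bounded_coboundaries G (2 + Suc q)"
    if \<omega>: "\<omega> \<in> \<alpha>" and u: "u \<in> quasimorphism_class G (decomposable l \<Delta>)" for \<omega> u
  proof -
    have \<omega>: "\<omega> \<in> bounded_cocycles G (Suc q)" using \<omega> bounded_cohomology_classD[OF \<alpha>] by blast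
    obtain h where h: "h \<in> bounded_cochains G 1"
      and u: "u = (\<lambda>xs. 1 * coboundary G 1 h xs + 1 * coboundary G 1 phi xs)"
      by (rule quasimorphism_classE[OF u])
    \<comment> \<open>The same two contributions as on the left; no sign occurs because
      \<open>h\<close> is now the first factor.\<close>
    let ?b = "\<lambda>xs. 1 * cup_cochain G 1 (Suc q) h \<omega> xs + 1 * right_primitive q \<omega> xs"
    have "cup_cochain G 1 (Suc q) h \<omega> \<in> bounded_cochains G (Suc (Suc q))"
      using cup_bounded[OF h bounded_cocycleD(1)[OF \<omega>]] by simp
    then have b: "?b \<in> bounded_cochains G (Suc (Suc q))"
      using right_primitive(1)[OF \<omega>] by (rule bounded_cochains_lincomb)
    have "coboundary G (Suc (Suc q)) ?b = cup_cochain G 2 (Suc q) u \<omega>"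
      unfolding u coboundary_lincomb cup_cochain_lincomb_left right_primitive(2)[OF \<omega>]
      using coboundary_cup_cocycle_right[OF bounded_cocycleD(2)[OF \<omega>], of 1 h]
      by (simp add: numeral_2_eq_2)
    then show ?thesis using cohomology_class_coboundary[OF b] by simp
  qed
  then show ?thesis
    using bounded_cohomology_classD(2)[OF \<alpha>] hat_in_quasimorphism_class
    unfolding cup_product_def by (auto cong: SUP_cong)
qed

text \<open>Triviality asks for one choice of data giving 0: arbitrary representatives of the outer
  classes, the coboundary of \<open>phi\<close> in the middle and the two explicit
  primitives.\<close>

lemma massey_product_trivial:
  assumes \<alpha>\<^sub>1: "\<alpha>\<^sub>1 \<in> carrier (bounded_cohomology G (Suc p))"
    and \<alpha>\<^sub>2: "\<alpha>\<^sub>2 \<in> carrier (bounded_cohomology G (Suc q))"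
  shows "bounded_coboundaries G (Suc p + Suc q + 1)
    \<in> massey_product G (Suc p) 2 (Suc q) \<alpha>\<^sub>1 (quasimorphism_class G (decomposable l \<Delta>)) \<alpha>\<^sub>2"
proof -
  obtain \<omega>\<^sub>1 \<omega>\<^sub>2 where mem: "\<omega>\<^sub>1 \<in> \<alpha>\<^sub>1" "\<omega>\<^sub>2 \<in> \<alpha>\<^sub>2"
    using bounded_cohomology_classD(2) \<alpha>\<^sub>1 \<alpha>\<^sub>2 by blast
  then have \<omega>: "\<omega>\<^sub>1 \<in> bounded_cocycles G (Suc p)" "\<omega>\<^sub>2 \<in> bounded_cocycles G (Suc q)"
    using bounded_cohomology_classD(1) \<alpha>\<^sub>1 \<alpha>\<^sub>2 by blast+
  obtain \<theta> where \<theta>: "\<theta> \<in> bounded_cochains G (Suc p + Suc q)"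
    "coboundary G (Suc p + Suc q) \<theta> = (\<lambda>xs.
       (- 1) ^ Suc p * cup_cochain G (Suc p) (Suc (Suc q)) \<omega>\<^sub>1 (right_primitive q \<omega>\<^sub>2) xs
       - cup_cochain G (Suc (Suc p)) (Suc q) (left_primitive p \<omega>\<^sub>1) \<omega>\<^sub>2 xs)"
    by (rule massey_representative[OF \<omega>])
  have deg: "Suc p + Suc q + 2 - 1 = Suc (Suc p + Suc q)" "2 + Suc q - 1 = Suc (Suc q)"
    "Suc p + 2 - 1 = Suc (Suc p)" by simp_all
  have rep: "cohomology_class G (Suc (Suc p + Suc q)) (\<lambda>xs. (- 1) ^ 2 *
       ((- 1) ^ Suc p * cup_cochain G (Suc p) (Suc (Suc q)) \<omega>\<^sub>1 (right_primitive q \<omega>\<^sub>2) xs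
       - cup_cochain G (Suc (Suc p)) (Suc q) (left_primitive p \<omega>\<^sub>1) \<omega>\<^sub>2 xs))
      = bounded_coboundaries G (Suc p + Suc q + 1)"
    using cohomology_class_coboundary[OF \<theta>(1)] unfolding \<theta>(2) by simp
  show ?thesis
    unfolding massey_product_def deg mem_Collect_eq
    by (intro exI conjI) (rule rep[symmetric] mem hat_in_quasimorphism_class
      left_primitive[OF \<omega>(1)] right_primitive[OF \<omega>(2)])+
qed

end

section \<open>Decompositions of free groups\<close>

lemma reduced_word_freely_generated:
  assumes "freely_generated G S" "g \<in> carrier G"
  shows "word_eval G (reduced_word G S g) = g" "reduced_word G S g \<in> reduced_words S"
  using assms unfolding freely_generated_def reduced_word_def bij_betw_def
  by (auto intro: f_inv_into_f inv_into_into)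

lemma (in group) reduced_word_one:
  assumes "freely_generated G S"
  shows "reduced_word G S \<one> = []"
proof -
  have "[] \<in> reduced_words S" by (simp add: reduced_words_def)
  moreover have "word_eval G [] = \<one>" by (simp add: word_eval_def)
  ultimately show ?thesis
    using assms unfolding freely_generated_def reduced_word_def bij_betw_def
    by (metis inv_into_f_f)
qed

lemma (in group) word_eval_append:
  assumes "S \<subseteq> carrier G" "fst ` set v \<subseteq> S" "fst ` set w \<subseteq> S"
  shows "word_eval G (v @ w) = word_eval G v \<otimes> word_eval G w"
proof -
  have "set (map (\<lambda>(s, b). if b then s else inv s) u) \<subseteq> carrier G" if "fst ` set u \<subseteq> S" for u
    using that assms(1) by force
  then show ?thesis
    unfolding word_eval_def map_append using assms by (intro group_prod_append) auto
qed

text \<open>For \<open>\<Delta> g\<close>, clause (1) identifies the concatenation with the reduced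
  word of \<open>g\<close>, which gives \<open>prod_\<Delta>\<close>.\<close>

lemma (in group) group_prod_decomposition:
  assumes S: "freely_generated G S" and xs: "set xs \<subseteq> carrier G"
  shows "word_eval G (concat (map (reduced_word G S) xs)) = group_prod G xs"
  using xs
proof (induction xs)
  case (Cons x xs)
  have letters: "fst ` set (reduced_word G S y) \<subseteq> S" if "y \<in> carrier G" for y
    using reduced_word_freely_generated(2)[OF S that] by (simp add: reduced_words_def)
  then have "fst ` set (concat (map (reduced_word G S) xs)) \<subseteq> S" using Cons.prems by fastforce
  then show ?case
    using Cons S letters[of x] reduced_word_freely_generated(1)[OF S, of x]
    by (simp add: word_eval_append[of S] freely_generated_def)
qed (simp add: word_eval_def)

text \<open>Taking \<open>max 0 B\<close> meets the sign condition of the locale even for a negative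
  \<open>B\<close>.\<close>

lemma (in group) weighted_decompositionI:
  assumes S: "freely_generated G S" and P: "symmetric_subset G P" "\<one> \<notin> P"
    and \<Delta>: "decomposition G S P \<Delta>"
    and lB: "\<forall>p \<in> P. \<bar>l p\<bar> \<le> B" and linv: "\<forall>p \<in> P. l (inv p) = - l p"
  obtains R where "weighted_decomposition G P \<Delta> R l (max 0 B)"
proof -
  have P': "P \<subseteq> carrier G" "\<And>p. p \<in> P \<Longrightarrow> inv p \<in> P"
    using P by (auto simp: symmetric_subset_def)
  have pieces: "\<And>g. g \<in> carrier G \<Longrightarrow> set (\<Delta> g) \<subseteq> P"
    and words: "\<And>g. g \<in> carrier G \<Longrightarrow>
      reduced_word G S g = concat (map (reduced_word G S) (\<Delta> g))"
    and inverse: "\<And>g. g \<in> carrier G \<Longrightarrow> \<Delta> (inv g) = seq_inv G (\<Delta> g)"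
    and sub: "\<And>g i j. g \<in> carrier G \<Longrightarrow> i \<le> j \<Longrightarrow> j < length (\<Delta> g) \<Longrightarrow>
      \<Delta> (group_prod G (map (\<lambda>k. \<Delta> g ! k) [i..<Suc j])) = map (\<lambda>k. \<Delta> g ! k) [i..<Suc j]"
    using \<Delta> unfolding decomposition_def Let_def by blast+
  obtain R where R: "\<forall>g \<in> carrier G. \<forall>h \<in> carrier G. \<forall>r\<^sub>1 \<in> lists P. \<forall>r\<^sub>2 \<in> lists P. \<forall>r\<^sub>3 \<in> lists P.
      \<Delta> g = longest_common_prefix (\<Delta> g) (\<Delta> (g \<otimes> h)) @ r\<^sub>1
        @ seq_inv G (longest_common_prefix (\<Delta> (inv g)) (\<Delta> h)) \<and>
      \<Delta> h = longest_common_prefix (\<Delta> (inv g)) (\<Delta> h) @ r\<^sub>2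
        @ seq_inv G (longest_common_prefix (\<Delta> (inv h)) (\<Delta> (inv (g \<otimes> h)))) \<and>
      \<Delta> (g \<otimes> h) = longest_common_prefix (\<Delta> g) (\<Delta> (g \<otimes> h)) @ seq_inv G r\<^sub>3
        @ seq_inv G (longest_common_prefix (\<Delta> (inv h)) (\<Delta> (inv (g \<otimes> h))))
      \<longrightarrow> length r\<^sub>1 \<le> R \<and> length r\<^sub>2 \<le> R \<and> length r\<^sub>3 \<le> R"
    using \<Delta>[unfolded decomposition_def Let_def, THEN conjunct2, THEN conjunct2, THEN conjunct2,
        THEN conjunct2] by (elim exE) (rule that)
  \<comment> \<open>Clause (3) speaks of nonempty infixes; this settles the empty one. A piece of
    \<one> would have an empty reduced word and thus be \<one>, which is not in
    \<open>P\<close>.\<close>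
  have "\<Delta> \<one> = []"
  proof (rule ccontr)
    assume "\<Delta> \<one> \<noteq> []"
    then obtain p where p: "p \<in> set (\<Delta> \<one>)" by (cases "\<Delta> \<one>") auto
    then have "p \<in> P" "p \<in> carrier G" using pieces[of \<one>] P' by auto
    moreover have "reduced_word G S p = []"
      using words[of \<one>] p by (simp add: reduced_word_one[OF S])
    ultimately have "p = \<one>"
      using reduced_word_freely_generated(1)[OF S, of p] by (simp add: word_eval_def)
    then show False using \<open>p \<in> P\<close> P(2) by simp
  qed
  have "weighted_decomposition G P \<Delta> R l (max 0 B)"
  proof (unfold_locales)
    fix g assume g: "g \<in> carrier G"
    show "group_prod G (\<Delta> g) = g"
      using group_prod_decomposition[OF S, of "\<Delta> g"] words[OF g] pieces[OF g] P'(1)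
        reduced_word_freely_generated(1)[OF S g] by auto
    fix xs ys zs assume eq: "\<Delta> g = xs @ ys @ zs"
    show "\<Delta> (group_prod G ys) = ys"
    proof (cases "ys = []")
      case True
      then show ?thesis using \<open>\<Delta> \<one> = []\<close> by simp
    next
      case False
      \<comment> \<open>The index of the last entry of \<open>ys\<close>; the subtraction is exact
        because \<open>ys\<close> is nonempty.\<close>
      let ?j = "length xs + length ys - 1"
      have m: "map (\<lambda>k. \<Delta> g ! k) [length xs..<Suc ?j] = ys"
        using False by (intro nth_equalityI) (auto simp: eq nth_append)
      have "length xs \<le> ?j" "?j < length (\<Delta> g)"
        using False by (cases ys; simp add: eq)+
      then show ?thesis using sub[OF g, of "length xs" ?j] unfolding m by simp
    qed
  next
    fix g h d\<^sub>1 d\<^sub>2 d\<^sub>3 r\<^sub>1 r\<^sub>2 r\<^sub>3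
    assume gh: "g \<in> carrier G" "h \<in> carrier G" and d: "d\<^sub>1 = longest_common_prefix (\<Delta> g) (\<Delta> (g \<otimes> h))"
      "d\<^sub>2 = longest_common_prefix (\<Delta> (inv g)) (\<Delta> h)"
      "d\<^sub>3 = longest_common_prefix (\<Delta> (inv h)) (\<Delta> (inv (g \<otimes> h)))"
      and r: "set r\<^sub>1 \<subseteq> P" "set r\<^sub>2 \<subseteq> P" "set r\<^sub>3 \<subseteq> P"
      and eqs: "\<Delta> g = d\<^sub>1 @ r\<^sub>1 @ seq_inv G d\<^sub>2" "\<Delta> h = d\<^sub>2 @ r\<^sub>2 @ seq_inv G d\<^sub>3"
      "\<Delta> (g \<otimes> h) = d\<^sub>1 @ seq_inv G r\<^sub>3 @ seq_inv G d\<^sub>3"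
    have "r\<^sub>1 \<in> lists P" "r\<^sub>2 \<in> lists P" "r\<^sub>3 \<in> lists P"
      using r by (simp_all add: in_lists_conv_set subset_iff)
    note R' = R[THEN bspec, OF gh(1), THEN bspec, OF gh(2), THEN bspec, OF this(1),
        THEN bspec, OF this(2), THEN bspec, OF this(3), folded d]
    show "length r\<^sub>1 \<le> R \<and> length r\<^sub>2 \<le> R \<and> length r\<^sub>3 \<le> R"
      by (rule R'[THEN mp]) (intro conjI eqs)
  qed (use P' pieces inverse lB linv in \<open>auto simp: le_max_iff_disj\<close>)
  then show thesis by (rule that)
qed

text \<open>Degrees start at 1: the constant 1 in degree 0 is a unit for the cup product, so there
  the product would be the class of the quasimorphism itself, which may be nonzero.\<close>

theorem theorem5p11:
  fixes F :: "('a, 'b) monoid_scheme" and S P :: "'a set"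
    and \<Delta> :: "'a \<Rightarrow> 'a list" and l :: "'a \<Rightarrow> real"
  assumes "group F" and "freely_generated F S" and "\<not> comm_group F"
    and "symmetric_subset F P" and "\<one>\<^bsub>F\<^esub> \<notin> P"
    and "decomposition F S P \<Delta>"
    and "\<exists>B. \<forall>p \<in> P. \<bar>l p\<bar> \<le> B"
    and "\<forall>p \<in> P. l (inv\<^bsub>F\<^esub> p) = - l p"
  shows "quasimorphism F (decomposable l \<Delta>) \<and>
    (\<forall>n \<ge> 1. \<forall>m \<ge> 1.
       \<forall>\<alpha>\<^sub>1 \<in> carrier (bounded_cohomology F n). \<forall>\<alpha>\<^sub>2 \<in> carrier (bounded_cohomology F m).
         cup_product F n 2 \<alpha>\<^sub>1 (quasimorphism_class F (decomposable l \<Delta>))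
           = \<one>\<^bsub>bounded_cohomology F (n + 2)\<^esub> \<and>
         cup_product F 2 m (quasimorphism_class F (decomposable l \<Delta>)) \<alpha>\<^sub>2
           = \<one>\<^bsub>bounded_cohomology F (2 + m)\<^esub> \<and>
         \<one>\<^bsub>bounded_cohomology F (n + m + 1)\<^esub>
           \<in> massey_product F n 2 m \<alpha>\<^sub>1 (quasimorphism_class F (decomposable l \<Delta>)) \<alpha>\<^sub>2)"
proof -
  interpret group F by (rule assms)
  obtain B where B: "\<forall>p \<in> P. \<bar>l p\<bar> \<le> B" using assms(7) by blast
  obtain R where "weighted_decomposition F P \<Delta> R l (max 0 B)"
    by (rule weighted_decompositionI[OF assms(2,4,5,6) B assms(8)])
  then interpret weighted_decomposition F P \<Delta> R l "max 0 B" .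
  show ?thesis
  proof (intro conjI allI impI ballI)
    show "quasimorphism F (decomposable l \<Delta>)" by (rule quasimorphism_decomposable)
  next
    fix n m :: nat and \<alpha>\<^sub>1 \<alpha>\<^sub>2
    assume nm: "1 \<le> n" "1 \<le> m" and \<alpha>: "\<alpha>\<^sub>1 \<in> carrier (bounded_cohomology F n)"
      "\<alpha>\<^sub>2 \<in> carrier (bounded_cohomology F m)"
    obtain p q where pq: "n = Suc p" "m = Suc q"
      using nm by (cases n; cases m) auto
    note \<alpha>' = \<alpha>[unfolded pq]
    show "cup_product F n 2 \<alpha>\<^sub>1 (quasimorphism_class F (decomposable l \<Delta>))
        = \<one>\<^bsub>bounded_cohomology F (n + 2)\<^esub>"
      unfolding pq bounded_cohomology_one by (rule cup_product_left_trivial[OF \<alpha>'(1)])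
    show "cup_product F 2 m (quasimorphism_class F (decomposable l \<Delta>)) \<alpha>\<^sub>2
        = \<one>\<^bsub>bounded_cohomology F (2 + m)\<^esub>"
      unfolding pq bounded_cohomology_one by (rule cup_product_right_trivial[OF \<alpha>'(2)])
    show "\<one>\<^bsub>bounded_cohomology F (n + m + 1)\<^esub>
        \<in> massey_product F n 2 m \<alpha>\<^sub>1 (quasimorphism_class F (decomposable l \<Delta>)) \<alpha>\<^sub>2"
      unfolding pq bounded_cohomology_one by (rule massey_product_trivial[OF \<alpha>'])
  qed
qed

end
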